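(* Let $M$ be a smooth compact manifold without boundary, $\dim M=d$. Fix $t>0$ and $p\in C(M)$ with $p(x)>0$ for all $x\in M$. For any $C^2$ Riemannian metric $g$ on $M$, define the operator $L^{(g)}_{t,p}$ on $C(M)$ by $$(L^{(g)}_{t,p} f)(x):=\frac{1}{t^{\frac d2+1}}\int_M \exp\Big(-\frac{d_g(x,y)^2}{t}\Big)\,\bigl(f(x)-f(y)\bigr)\,p(y)\,d\mu_g(y),\qquad f\in C(M),\ x\in M.$$ If $g_1,g_2$ are $C^2$ Riemannian metrics on $M$ such that $L^{(g_1)}_{t,p}=L^{(g_2)}_{t,p}$ as operators on $C(M)$, then $g_1=g_2$.
   Context: $C(M)$ denotes the space of continuous real-valued functions on $M$. For a Riemannian metric $g$ on $M$, $d_g$ denotes the geodesic (intrinsic) distance induced by $g$, i.e. the infimum of $g$-lengths of piecewise $C^1$ curves joining two points (if $M$ is disconnected, $d_g(x,y)=+\infty$ for points in different components and $\exp(-\infty)=0$), and $\mu_g$ denotes the Riemannian volume measure of $g$. *)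

theory Defs
  imports "HOL-Analysis.Analysis"
begin

section \<open>Functions of class \<open>C\<^sup>k\<close>\<close>

text \<open>Intended for open \<open>S\<close>; in finite dimension the directional derivatives below are
  \<open>C\<^sup>k\<close> for every direction \<open>v\<close> iff all partial derivatives are.\<close>

primrec Ck_on :: "nat \<Rightarrow> ('a::real_normed_vector \<Rightarrow> 'b::real_normed_vector) \<Rightarrow> 'a set \<Rightarrow> bool" where
  "Ck_on 0 f S \<longleftrightarrow> continuous_on S f"
| "Ck_on (Suc k) f S \<longleftrightarrow>
     (\<forall>x\<in>S. f differentiable (at x)) \<and>
     (\<forall>v. Ck_on k (\<lambda>x. frechet_derivative f (at x) v) S)"

section \<open>Smooth manifolds\<close>

text \<open>A manifold is a subspace \<open>M\<close> of a Hausdorff space with an atlas \<open>A\<close>. A chart is a pair of a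
  relatively open domain \<open>U\<close> and a map whose values outside \<open>U\<close> are irrelevant. The model space
  is \<open>real ^ 'n\<close>, so the dimension is \<open>CARD('n)\<close>, and all charts map onto open subsets of it (no
  boundary). Second countability is not required: it follows when \<open>M\<close> is compact.\<close>

type_synonym ('m, 'n) chart = "'m set \<times> ('m \<Rightarrow> real ^ 'n)"

abbreviation chart_dom :: "('m, 'n) chart \<Rightarrow> 'm set" where
  "chart_dom c \<equiv> fst c"

abbreviation chart_map :: "('m, 'n) chart \<Rightarrow> 'm \<Rightarrow> real ^ 'n" where
  "chart_map c \<equiv> snd c"

definition chart_inv :: "('m, 'n) chart \<Rightarrow> real ^ 'n \<Rightarrow> 'm" where
  "chart_inv c = inv_into (chart_dom c) (chart_map c)"

definition is_chart :: "'m::topological_space set \<Rightarrow> ('m, 'n::finite) chart \<Rightarrow> bool" where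
  "is_chart M c \<longleftrightarrow>
     openin (top_of_set M) (chart_dom c) \<and>
     open (chart_map c ` chart_dom c) \<and>
     homeomorphism (chart_dom c) (chart_map c ` chart_dom c) (chart_map c) (chart_inv c)"

definition transition :: "('m, 'n) chart \<Rightarrow> ('m, 'n) chart \<Rightarrow> real ^ 'n \<Rightarrow> real ^ 'n" where
  "transition c c' = chart_map c' \<circ> chart_inv c"

definition smooth_atlas :: "'m::topological_space set \<Rightarrow> ('m, 'n::finite) chart set \<Rightarrow> bool" where
  "smooth_atlas M A \<longleftrightarrow>
     (\<forall>c\<in>A. is_chart M c) \<and>
     (\<Union>c\<in>A. chart_dom c) = M \<and>
     (\<forall>c\<in>A. \<forall>c'\<in>A. \<forall>k.
        Ck_on k (transition c c') (chart_map c ` (chart_dom c \<inter> chart_dom c')))"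

definition charts_at :: "('m, 'n) chart set \<Rightarrow> 'm \<Rightarrow> ('m, 'n) chart set" where
  "charts_at A x = {c \<in> A. x \<in> chart_dom c}"

section \<open>Tangent vectors\<close>

text \<open>A tangent vector at \<open>x\<close> assigns to every chart around \<open>x\<close> a coordinate vector, compatibly with
  the differentials of the transition maps; it is extended by \<open>0\<close> to all other charts. The vector
  space structure is pointwise, and each chart around \<open>x\<close> gives an isomorphism onto \<open>real ^ 'n\<close>.\<close>

type_synonym ('m, 'n) tangent = "('m, 'n) chart \<Rightarrow> real ^ 'n"

definition tangent_space ::
    "('m, 'n::finite) chart set \<Rightarrow> 'm \<Rightarrow> ('m, 'n) tangent set" where
  "tangent_space A x =
     {v. (\<forall>c\<in>charts_at A x. \<forall>c'\<in>charts_at A x.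
            v c' = frechet_derivative (transition c c') (at (chart_map c x)) (v c)) \<and>
         (\<forall>c. c \<notin> charts_at A x \<longrightarrow> v c = 0)}"

text \<open>The tangent vector at \<open>x\<close> with coordinates \<open>u\<close> in the chart \<open>c\<close>.\<close>

definition tangent_of ::
    "('m, 'n::finite) chart set \<Rightarrow> ('m, 'n) chart \<Rightarrow> 'm \<Rightarrow> real ^ 'n \<Rightarrow> ('m, 'n) tangent" where
  "tangent_of A c x u =
     (\<lambda>c'. if c' \<in> charts_at A x
           then frechet_derivative (transition c c') (at (chart_map c x)) u else 0)"

section \<open>Riemannian metrics\<close>

type_synonym ('m, 'n) metric = "'m \<Rightarrow> ('m, 'n) tangent \<Rightarrow> ('m, 'n) tangent \<Rightarrow> real"

text \<open>The coefficients \<open>g\<^sub>i\<^sub>j\<close> in a chart, as functions on the image of the chart.\<close>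

definition gram ::
    "('m, 'n::finite) chart set \<Rightarrow> ('m, 'n) metric \<Rightarrow> ('m, 'n) chart \<Rightarrow> real ^ 'n \<Rightarrow> real ^ 'n ^ 'n" where
  "gram A g c z =
     (\<chi> i j. g (chart_inv c z)
                (tangent_of A c (chart_inv c z) (axis i 1))
                (tangent_of A c (chart_inv c z) (axis j 1)))"

definition riemannian_metric ::
    "nat \<Rightarrow> 'm::topological_space set \<Rightarrow> ('m, 'n::finite) chart set \<Rightarrow> ('m, 'n) metric \<Rightarrow> bool" where
  "riemannian_metric k M A g \<longleftrightarrow>
     (\<forall>x\<in>M.
        (\<forall>u\<in>tangent_space A x. \<forall>v\<in>tangent_space A x. \<forall>w\<in>tangent_space A x.
           g x (\<lambda>c. u c + v c) w = g x u w + g x v w) \<and>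
        (\<forall>a. \<forall>v\<in>tangent_space A x. \<forall>w\<in>tangent_space A x.
           g x (\<lambda>c. a *\<^sub>R v c) w = a * g x v w) \<and>
        (\<forall>v\<in>tangent_space A x. \<forall>w\<in>tangent_space A x. g x v w = g x w v) \<and>
        (\<forall>v\<in>tangent_space A x. v \<noteq> (\<lambda>_. 0) \<longrightarrow> g x v v > 0)) \<and>
     (\<forall>c\<in>A. \<forall>i j. Ck_on k (\<lambda>z. gram A g c z $ i $ j) (chart_map c ` chart_dom c))"

section \<open>Geodesic distance\<close>

definition C1_curve_on ::
    "('m, 'n::finite) chart set \<Rightarrow> real \<Rightarrow> real \<Rightarrow> (real \<Rightarrow> 'm) \<Rightarrow> bool" where
  "C1_curve_on A a b \<gamma> \<longleftrightarrow>
     (\<forall>c\<in>A. \<exists>D.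
        (\<forall>s\<in>{s\<in>{a..b}. \<gamma> s \<in> chart_dom c}.
           ((chart_map c \<circ> \<gamma>) has_vector_derivative D s) (at s within {a..b})) \<and>
        continuous_on {s\<in>{a..b}. \<gamma> s \<in> chart_dom c} D)"

definition piecewise_C1_curve ::
    "'m::topological_space set \<Rightarrow> ('m, 'n::finite) chart set \<Rightarrow> (real \<Rightarrow> 'm) \<Rightarrow> bool" where
  "piecewise_C1_curve M A \<gamma> \<longleftrightarrow>
     continuous_on {0..1} \<gamma> \<and> \<gamma> ` {0..1} \<subseteq> M \<and>
     (\<exists>(N::nat) \<tau>. \<tau> 0 = 0 \<and> \<tau> N = 1 \<and>
        (\<forall>i<N. \<tau> i < \<tau> (Suc i) \<and> C1_curve_on A (\<tau> i) (\<tau> (Suc i)) \<gamma>))"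

definition velocity ::
    "('m, 'n::finite) chart set \<Rightarrow> (real \<Rightarrow> 'm) \<Rightarrow> real \<Rightarrow> ('m, 'n) tangent" where
  "velocity A \<gamma> s =
     (\<lambda>c. if c \<in> charts_at A (\<gamma> s) then vector_derivative (chart_map c \<circ> \<gamma>) (at s) else 0)"

text \<open>The two-sided derivative in \<open>velocity\<close> may be meaningless at the finitely many break points
  of the curve (end points included), which does not affect the integral.\<close>

definition curve_length ::
    "('m, 'n::finite) chart set \<Rightarrow> ('m, 'n) metric \<Rightarrow> (real \<Rightarrow> 'm) \<Rightarrow> real" where
  "curve_length A g \<gamma> =
     integral {0..1} (\<lambda>s. sqrt (g (\<gamma> s) (velocity A \<gamma> s) (velocity A \<gamma> s)))"

text \<open>The value is \<open>\<infinity>\<close>, the infimum of the empty set, if no curve joins the two points.\<close>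

definition geodesic_dist ::
    "'m::topological_space set \<Rightarrow> ('m, 'n::finite) chart set \<Rightarrow> ('m, 'n) metric \<Rightarrow> 'm \<Rightarrow> 'm \<Rightarrow> ereal" where
  "geodesic_dist M A g x y =
     (INF \<gamma>\<in>{\<gamma>. piecewise_C1_curve M A \<gamma> \<and> \<gamma> 0 = x \<and> \<gamma> 1 = y}. ereal (curve_length A g \<gamma>))"

section \<open>Riemannian volume\<close>

text \<open>The Borel measure on \<open>M\<close> which in every chart has density \<open>sqrt (det g\<^sub>i\<^sub>j)\<close> with respect to
  Lebesgue measure. It is unique on a compact \<open>M\<close>, since finitely many chart domains cover \<open>M\<close>, and
  exists by the change of variables formula.\<close>

definition is_riemannian_volume ::
    "'m::topological_space set \<Rightarrow> ('m, 'n::finite) chart set \<Rightarrow> ('m, 'n) metric \<Rightarrow> 'm measure \<Rightarrow> bool" where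
  "is_riemannian_volume M A g \<mu> \<longleftrightarrow>
     space \<mu> = M \<and> sets \<mu> = sets (restrict_space borel M) \<and>
     (\<forall>c\<in>A. \<forall>B\<in>sets \<mu>. B \<subseteq> chart_dom c \<longrightarrow>
        emeasure \<mu> B =
          (\<integral>\<^sup>+z\<in>chart_map c ` B. ennreal (sqrt (det (gram A g c z))) \<partial>lborel))"

definition riemannian_volume ::
    "'m::topological_space set \<Rightarrow> ('m, 'n::finite) chart set \<Rightarrow> ('m, 'n) metric \<Rightarrow> 'm measure" where
  "riemannian_volume M A g = (THE \<mu>. is_riemannian_volume M A g \<mu>)"

section \<open>The operator\<close>

text \<open>The value \<open>exp (- D\<^sup>2 / t)\<close>, with \<open>exp (-\<infinity>) = 0\<close>.\<close>

definition gauss_kernel :: "real \<Rightarrow> ereal \<Rightarrow> real" where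
  "gauss_kernel t D = (if D = \<infinity> then 0 else exp (- (real_of_ereal D)\<^sup>2 / t))"

definition L_op ::
    "'m::topological_space set \<Rightarrow> ('m, 'n::finite) chart set \<Rightarrow> real \<Rightarrow> ('m \<Rightarrow> real) \<Rightarrow>
     ('m, 'n) metric \<Rightarrow> ('m \<Rightarrow> real) \<Rightarrow> 'm \<Rightarrow> real" where
  "L_op M A t p g f x =
     1 / t powr (real CARD('n) / 2 + 1) *
     (\<integral>y. gauss_kernel t (geodesic_dist M A g x y) * (f x - f y) * p y \<partial>riemannian_volume M A g)"

end

theory Submission
  imports Defs
begin

text \<open>The operator determines its kernel. Let \<open>f\<close> be a function that vanishes at \<open>x\<close> and is
  concentrated near another point \<open>y\<close>. Up to a constant factor, \<open>L f x\<close> is then the integral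
  of \<open>exp (- d(x,y)\<^sup>2 / t) f(y) p(y)\<close> against the volume, whose density in a chart is
  \<open>sqrt (det g\<^sub>i\<^sub>j)\<close>. Testing with tents around every \<open>y \<noteq> x\<close> near \<open>x\<close>, and using that all
  functions involved are continuous, one finds that
  \<open>exp (- d(x,y)\<^sup>2 / t) sqrt (det g\<^sub>i\<^sub>j(y))\<close> is the same for both metrics. As \<open>y\<close> tends to
  \<open>x\<close>, the exponential tends to \<open>1\<close>, so the two volume densities agree at \<open>x\<close>. As \<open>x\<close> was
  arbitrary, the densities agree everywhere; hence so do the exponentials, that is,
  \<open>d\<^sub>1(x,y) = d\<^sub>2(x,y)\<close> for all \<open>y\<close> near \<open>x\<close>.

  The geodesic distance in turn determines the metric, because in a chart with \<open>z\<close> the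
  coordinates of \<open>x\<close> the distance from \<open>z\<close> to \<open>z + h v\<close> is asymptotic to \<open>h |v|\<close>, where
  \<open>|v|\<close> is the norm given by the metric at \<open>z\<close>. On a small coordinate ball this norm changes
  by a factor of at most \<open>K\<close>, where \<open>K > 1\<close> is arbitrary (\<open>gram_norm_comparison\<close>). The
  straight segment then gives the upper bound \<open>d \<le> K h |v|\<close> (\<open>geodesic_dist_le_gram_norm\<close>).
  For the lower bound \<open>d \<ge> h |v| / K\<close> (\<open>gram_norm_le_geodesic_dist\<close>) a competing curve is
  followed either to its end or until it leaves the ball; in the second case it is already
  too long. Equal distances therefore give \<open>|v|\<^sub>1 \<le> K\<^sup>2 |v|\<^sub>2\<close> for all \<open>K > 1\<close>, so the norms
  agree by symmetry, and the metrics agree by polarization.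

  Two facts must be in place before this argument starts. The kernel has to be continuous
  near \<open>x\<close>, which follows from the triangle inequality and the upper bound above
  (\<open>geodesic_dist_chart_continuous\<close>). And the Riemannian volume, which is defined by a
  description, has to exist and be unique (\<open>ex1_riemannian_volume\<close>): finitely many charts
  cover \<open>M\<close>, the volume is the sum of the chart volumes over a partition subordinate to
  them, and the change of variables formula makes this independent of the charts.\<close>

section \<open>Change of variables over an arbitrary finite index type\<close>

text \<open>The change of variables theorem needs a well-ordered index type. For a finite type \<open>'n\<close> the
  numbers below \<open>CARD('n)\<close> form such a type of the same size; permuting coordinates transports the
  theorem back to \<open>'n\<close>.\<close>

typedef ('n::finite) ranked = "{..<CARD('n)}"
  by (rule exI[of _ 0]) simp

instantiation ranked :: (finite) wellorder
begin
definition "i \<le> j \<longleftrightarrow> Rep_ranked i \<le> Rep_ranked j"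
definition "i < j \<longleftrightarrow> Rep_ranked i < Rep_ranked j"
instance
proof
  fix P :: "'a ranked \<Rightarrow> bool" and i
  assume step: "\<And>i. (\<And>j. j < i \<Longrightarrow> P j) \<Longrightarrow> P i"
  show "P i"
  proof (induction "Rep_ranked i" arbitrary: i rule: less_induct)
    case less
    show ?case
      by (rule step, rule less) (simp add: less_ranked_def)
  qed
qed (simp_all add: less_eq_ranked_def less_ranked_def less_le_not_le linear flip: Rep_ranked_inject)
end

lemma bij_Rep_ranked: "bij_betw (Rep_ranked :: 'n ranked \<Rightarrow> nat) UNIV {..<CARD('n::finite)}"
  by (rule bij_betw_imageI)
    (auto simp: inj_on_def Rep_ranked_inject type_definition.Rep_range[OF type_definition_ranked])

instance ranked :: (finite) finite
  by standard (metis bij_Rep_ranked bij_betw_finite finite_lessThan)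

lemma ex_bij_ranked: "\<exists>e :: 'n::finite ranked \<Rightarrow> 'n. bij e"
proof -
  obtain f where "bij_betw f {..<CARD('n)} (UNIV :: 'n set)"
    using ex_bij_betw_nat_finite[of "UNIV :: 'n set"] by (auto simp: lessThan_atLeast0)
  then show ?thesis
    using bij_betw_trans[OF bij_Rep_ranked] by blast
qed

definition permute_coords :: "('m \<Rightarrow> 'n) \<Rightarrow> real ^ 'n \<Rightarrow> real ^ 'm" where
  "permute_coords e x = (\<chi> i. x $ e i)"

lemma bounded_linear_permute_coords:
  "bounded_linear (permute_coords e :: real ^ 'n::finite \<Rightarrow> real ^ 'm::finite)"
  by (intro linear_conv_bounded_linear[THEN iffD1] linearI) (auto simp: permute_coords_def vec_eq_iff)

lemma permute_coords_inverse:
  assumes "bij e"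
  shows "permute_coords (inv e) (permute_coords e x) = x"
    and "permute_coords e (permute_coords (inv e) y) = y"
  using assms by (simp_all add: permute_coords_def vec_eq_iff bij_is_surj[THEN surj_f_inv_f] bij_is_inj[THEN inv_f_f])

lemma prod_Basis_cart:
  fixes f :: "real ^ 'n::finite \<Rightarrow> 'a::comm_monoid_mult"
  shows "(\<Prod>b\<in>Basis. f b) = (\<Prod>i\<in>UNIV. f (axis i 1))"
proof -
  have "inj (\<lambda>i::'n. axis i (1::real))"
    by (auto simp: inj_on_def axis_eq_axis)
  moreover have "(Basis :: (real ^ 'n) set) = range (\<lambda>i. axis i 1)"
    by (auto simp: Basis_vec_def)
  ultimately show ?thesis
    by (metis (no_types, lifting) prod.reindex_cong)
qed

lemma permute_coords_measurable [measurable]: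
  "(permute_coords e :: real ^ 'n::finite \<Rightarrow> real ^ 'm::finite) \<in> borel_measurable borel"
  by (intro borel_measurable_continuous_onI bounded_linear.continuous_on[OF bounded_linear_permute_coords]
      continuous_on_id)

text \<open>A permutation of the coordinates maps boxes to boxes with the same side lengths.\<close>

lemma distr_permute_coords:
  fixes e :: "'m::finite \<Rightarrow> 'n::finite"
  assumes e: "bij e"
  shows "distr lborel borel (permute_coords e) = lborel"
proof (rule lborel_eqI[symmetric])
  fix l u :: "real ^ 'm" assume lu: "\<And>b. b \<in> Basis \<Longrightarrow> l \<bullet> b \<le> u \<bullet> b"
  let ?l = "permute_coords (inv e) l" and ?u = "permute_coords (inv e) u"
  have lu': "l $ i \<le> u $ i" for i
    using lu[of "axis i 1"] by (simp add: inner_axis axis_in_Basis_iff)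
  have "permute_coords e -` box l u = box ?l ?u"
  proof -
    have "(\<forall>i. P (e i)) \<longleftrightarrow> (\<forall>j. P j)" for P
      using bij_is_surj[OF e] by (metis surjD)
    from this[of "\<lambda>j. l $ inv e j < x $ j \<and> x $ j < u $ inv e j" for x] show ?thesis
      using e by (auto simp: mem_box_cart permute_coords_def bij_is_inj inv_f_f)
  qed
  then have "emeasure (distr lborel borel (permute_coords e)) (box l u) = emeasure lborel (box ?l ?u)"
    by (simp add: emeasure_distr)
  also have "\<dots> = (\<Prod>b\<in>Basis. (?u - ?l) \<bullet> b)"
    by (intro emeasure_lborel_box) (auto simp: Basis_vec_def permute_coords_def inner_axis lu')
  also have "(\<Prod>b\<in>Basis. (?u - ?l) \<bullet> b) = (\<Prod>j\<in>UNIV. u $ inv e j - l $ inv e j)"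
    by (simp add: prod_Basis_cart permute_coords_def inner_axis)
  also have "\<dots> = (\<Prod>i\<in>UNIV. u $ i - l $ i)"
    by (rule prod.reindex_bij_betw[OF bij_betw_inv_into, OF e])
  also have "\<dots> = (\<Prod>b\<in>Basis. (u - l) \<bullet> b)"
    by (simp add: prod_Basis_cart permute_coords_def inner_axis)
  finally show "emeasure (distr lborel borel (permute_coords e)) (box l u) = (\<Prod>b\<in>Basis. (u - l) \<bullet> b)" .
qed simp

text \<open>Conjugation with the reindexing is a sign-preserving bijection between the two permutation groups
  in the Leibniz formula.\<close>

lemma det_reindex:
  fixes A :: "real ^ 'n::finite ^ 'n" and e :: "'m::finite \<Rightarrow> 'n"
  assumes e: "bij e"
  shows "det (\<chi> i j. A $ e i $ e j) = det A"
proof -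
  let ?h = "map_permutation UNIV e"
  have inv_e: "inv e (e i) = i" "e (inv e j) = j" for i j
    using e by (simp_all add: bij_is_inj bij_is_surj inv_f_f surj_f_inv_f)
  have h: "?h p = e \<circ> p \<circ> inv e" if "p permutes UNIV" for p
    using e by (auto simp: map_permutation_def fun_eq_iff bij_is_surj restrict_id_def)
  have bij: "bij_betw ?h {p. p permutes UNIV} {p. p permutes UNIV}"
  proof (rule bij_betwI[where g = "\<lambda>q. inv e \<circ> q \<circ> e"])
    show "?h \<in> {p. p permutes UNIV} \<rightarrow> {p. p permutes UNIV}"
      using map_permutation_permutes[OF bij_betw_subset[OF e], of UNIV UNIV] e by (auto simp: bij_is_surj)
    show "(\<lambda>q. inv e \<circ> q \<circ> e) \<in> {p. p permutes UNIV} \<rightarrow> {p. p permutes UNIV}"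
      using e by (auto intro!: bij_imp_permutes bij_comp bij_imp_bij_inv intro: permutes_bij)
    show "inv e \<circ> ?h p \<circ> e = p" if "p \<in> {p. p permutes UNIV}" for p
      using that by (simp add: h fun_eq_iff inv_e)
    show "?h (inv e \<circ> q \<circ> e) = q" if "q \<in> {q. q permutes UNIV}" for q
      using that e by (subst h) (auto simp: fun_eq_iff inv_e intro!: bij_imp_permutes bij_comp bij_imp_bij_inv intro: permutes_bij)
  qed
  have "(\<Prod>j\<in>UNIV. A $ j $ ?h p j) = (\<Prod>i\<in>UNIV. A $ e i $ e (p i))" if "p permutes UNIV" for p
    using prod.reindex_bij_betw[OF e, of "\<lambda>j. A $ j $ ?h p j"] by (simp add: h[OF that] inv_e)
  then have "of_int (sign (?h p)) * (\<Prod>j\<in>UNIV. A $ j $ ?h p j)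
      = of_int (sign p) * (\<Prod>i\<in>UNIV. A $ e i $ e (p i))" if "p permutes UNIV" for p
    using that e by (simp add: sign_map_permutation bij_is_inj)
  then show ?thesis
    unfolding det_def by (subst sum.reindex_bij_betw[OF bij, symmetric]) simp
qed


text \<open>The theorem for Henstock-Kurzweil integrals says that one side is integrable iff the other is. For
  nonnegative functions it therefore also covers infinite values.\<close>

lemma nn_integral_change_of_variables_wellorder:
  fixes g :: "real ^ 'n::{finite,wellorder} \<Rightarrow> real ^ 'n::_" and f :: "real ^ 'n::_ \<Rightarrow> real"
  assumes S: "S \<in> sets borel" "g ` S \<in> sets borel"
    and der: "\<And>x. x \<in> S \<Longrightarrow> (g has_derivative g' x) (at x within S)"
    and inj: "inj_on g S"
    and f_nonneg: "\<And>y. y \<in> g ` S \<Longrightarrow> f y \<ge> 0"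
    and f_meas: "set_borel_measurable borel (g ` S) f"
    and D_meas: "set_borel_measurable borel S (\<lambda>x. \<bar>det (matrix (g' x))\<bar> * f (g x))"
  shows "(\<integral>\<^sup>+y\<in>g ` S. ennreal (f y) \<partial>lborel)
       = (\<integral>\<^sup>+x\<in>S. ennreal (\<bar>det (matrix (g' x))\<bar> * f (g x)) \<partial>lborel)"
proof -
  let ?D = "\<lambda>x. \<bar>det (matrix (g' x))\<bar> * f (g x)"
  have iff: "(?D has_integral b) S \<longleftrightarrow> (f has_integral b) (g ` S)" for b
  proof -
    have D_nonneg: "\<And>x. x \<in> S \<Longrightarrow> 0 \<le> ?D x"
      using f_nonneg by simp
    \<comment> \<open>Real functions enter the vector-valued theorem as functions into \<open>real ^ 1\<close>.\<close>
    have "?D absolutely_integrable_on S \<and> integral S ?D = b \<longleftrightarrow>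
        f absolutely_integrable_on (g ` S) \<and> integral (g ` S) f = b"
      using has_absolute_integral_change_of_variables[OF _ der inj, of "\<lambda>y. vec (f y) :: real^1" "vec b"] S(1)
      unfolding absolutely_integrable_on_1_iff integral_on_1_eq integrable_on_1_iff
      by simp
    then show ?thesis
      by (simp add: has_integral_iff absolutely_integrable_on_iff_nonneg[OF D_nonneg]
          absolutely_integrable_on_iff_nonneg[OF f_nonneg])
  qed
  have *: "(\<exists>b. (h has_integral b) T \<and> (\<integral>\<^sup>+x\<in>T. ennreal (h x) \<partial>lborel) = ennreal b)
      \<or> (\<integral>\<^sup>+x\<in>T. ennreal (h x) \<partial>lborel) = \<infinity>"
    if "set_borel_measurable borel T h" "\<And>x. x \<in> T \<Longrightarrow> h x \<ge> 0" for h :: "real ^ 'n::_ \<Rightarrow> real" and T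
  proof (cases "(\<integral>\<^sup>+x\<in>T. ennreal (h x) \<partial>lborel) = \<infinity>")
    case False
    have eq: "(\<integral>\<^sup>+x\<in>T. ennreal (h x) \<partial>lborel) = (\<integral>\<^sup>+x. ennreal (indicator T x * h x) \<partial>lborel)"
      by (intro nn_integral_cong) (auto simp: indicator_def)
    have "(\<lambda>x. indicator T x * h x) integrable_on UNIV"
    proof (rule nn_integral_integrable_on)
      show "(\<integral>\<^sup>+x. ennreal (indicator T x * h x) \<partial>lborel) < \<infinity>"
        using False unfolding eq by (simp add: top.not_eq_extremum)
    qed (use that in \<open>auto simp: set_borel_measurable_def indicator_def\<close>)
    then have "h integrable_on T"
      by (simp add: indicator_def of_bool_def if_distrib[of "\<lambda>x. x * h y" for y] integrable_restrict_UNIV cong: if_cong)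
    then show ?thesis
      using nn_integral_has_integral_lebesgue'[of T h] that(2) by blast
  qed simp
  have D_nonneg: "\<And>x. x \<in> S \<Longrightarrow> 0 \<le> ?D x"
    using f_nonneg by simp
  show ?thesis
  proof (cases "\<exists>b. (f has_integral b) (g ` S)")
    case True
    then obtain b where "(f has_integral b) (g ` S)" "(?D has_integral b) S"
      using iff by blast
    then show ?thesis
      using nn_integral_has_integral_lebesgue'[of "g ` S" f b, OF f_nonneg]
        nn_integral_has_integral_lebesgue'[of S ?D b, OF D_nonneg]
      by simp
  next
    case False
    then have "\<nexists>b. (?D has_integral b) S"
      using iff by blast
    then have "(\<integral>\<^sup>+x\<in>S. ennreal (?D x) \<partial>lborel) = \<infinity>"
      using *[OF D_meas] D_nonneg by blast
    moreover have "(\<integral>\<^sup>+y\<in>g ` S. ennreal (f y) \<partial>lborel) = \<infinity>"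
      using *[OF f_meas] f_nonneg False by blast
    ultimately show ?thesis
      by simp
  qed
qed

text \<open>Conjugation with a permutation of the coordinates preserves Lebesgue measure, derivatives and
  Jacobian determinants.\<close>

lemma nn_integral_change_of_variables:
  fixes g :: "real ^ 'n::finite \<Rightarrow> real ^ 'n" and f :: "real ^ 'n \<Rightarrow> real"
  assumes S: "S \<in> sets borel" "g ` S \<in> sets borel"
    and der: "\<And>x. x \<in> S \<Longrightarrow> (g has_derivative g' x) (at x within S)"
    and inj: "inj_on g S"
    and f_nonneg: "\<And>y. y \<in> g ` S \<Longrightarrow> f y \<ge> 0"
    and f_meas: "set_borel_measurable borel (g ` S) f"
    and D_meas: "set_borel_measurable borel S (\<lambda>x. \<bar>det (matrix (g' x))\<bar> * f (g x))"
  shows "(\<integral>\<^sup>+y\<in>g ` S. ennreal (f y) \<partial>lborel)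
       = (\<integral>\<^sup>+x\<in>S. ennreal (\<bar>det (matrix (g' x))\<bar> * f (g x)) \<partial>lborel)"
proof -
  obtain e :: "'n ranked \<Rightarrow> 'n" where e: "bij e"
    using ex_bij_ranked by blast
  define P :: "real ^ 'n \<Rightarrow> real ^ 'n ranked" where "P = permute_coords e"
  define Q :: "real ^ 'n ranked \<Rightarrow> real ^ 'n" where "Q = permute_coords (inv e)"
  have QP [simp]: "Q (P x) = x" and PQ [simp]: "P (Q y) = y" for x y
    using e by (simp_all add: P_def Q_def permute_coords_inverse)
  have P_lin: "bounded_linear P" and Q_lin: "bounded_linear Q"
    by (simp_all add: P_def Q_def bounded_linear_permute_coords)
  have [measurable]: "P \<in> borel_measurable borel" "Q \<in> borel_measurable borel"
    by (simp_all add: P_def Q_def)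
  have image_P: "P ` X = Q -` X" for X
    by (auto simp: image_iff) (metis PQ)
  have transfer: "(\<integral>\<^sup>+x\<in>X. F x \<partial>lborel) = (\<integral>\<^sup>+y\<in>P ` X. F (Q y) \<partial>lborel)"
    if "X \<in> sets borel" "(\<lambda>x. F x * indicator X x) \<in> borel_measurable borel"
    for X and F :: "real ^ 'n \<Rightarrow> ennreal"
  proof -
    have "lborel = distr lborel borel Q"
      using e by (simp add: Q_def distr_permute_coords bij_imp_bij_inv)
    then have "(\<integral>\<^sup>+x\<in>X. F x \<partial>lborel) = (\<integral>\<^sup>+x\<in>X. F x \<partial>distr lborel borel Q)"
      by simp
    also have "\<dots> = (\<integral>\<^sup>+y. F (Q y) * indicator X (Q y) \<partial>lborel)"
      using that by (subst nn_integral_distr) auto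
    also have "\<dots> = (\<integral>\<^sup>+y\<in>P ` X. F (Q y) \<partial>lborel)"
      by (simp add: image_P indicator_vimage)
    finally show ?thesis .
  qed
  have measurable_ennreal: "(\<lambda>x. ennreal (h x) * indicator X x) \<in> borel_measurable borel"
    if "set_borel_measurable borel X h" for X and h :: "real ^ 'n \<Rightarrow> real"
  proof -
    have "(\<lambda>x. ennreal (h x) * indicator X x) = (\<lambda>x. ennreal (indicator X x *\<^sub>R h x))"
      by (auto simp: indicator_def)
    with that show ?thesis
      by (simp add: set_borel_measurable_def)
  qed
  have measurable_Q: "set_borel_measurable borel (P ` X) (\<lambda>y. h (Q y))"
    if "set_borel_measurable borel X h" for X and h :: "real ^ 'n \<Rightarrow> real"
    using measurable_compose[OF _ that[unfolded set_borel_measurable_def], of Q borel]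
    by (simp add: set_borel_measurable_def image_P indicator_vimage)
  let ?G = "P \<circ> g \<circ> Q" and ?G' = "\<lambda>y. P \<circ> g' (Q y) \<circ> Q"
  have GS: "?G ` (P ` S) = P ` (g ` S)"
    by (simp add: image_image)
  have det: "det (matrix (?G' y)) = det (matrix (g' (Q y)))" for y
  proof -
    have "Q (axis j 1) = axis (e j) 1" for j
      using e by (auto simp: Q_def permute_coords_def axis_def vec_eq_iff bij_is_inj inv_f_f
          bij_is_surj surj_f_inv_f)
    then have "matrix (?G' y) = (\<chi> i j. matrix (g' (Q y)) $ e i $ e j)"
      by (simp add: matrix_def P_def permute_coords_def)
    then show ?thesis
      by (simp add: det_reindex[OF e])
  qed
  have "(\<integral>\<^sup>+y\<in>g ` S. ennreal (f y) \<partial>lborel) = (\<integral>\<^sup>+y\<in>?G ` (P ` S). ennreal (f (Q y)) \<partial>lborel)"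
    unfolding GS by (rule transfer[OF S(2) measurable_ennreal[OF f_meas]])
  also have "\<dots> = (\<integral>\<^sup>+x\<in>P ` S. ennreal (\<bar>det (matrix (?G' x))\<bar> * f (Q (?G x))) \<partial>lborel)"
  proof (rule nn_integral_change_of_variables_wellorder)
    show "P ` S \<in> sets borel" "?G ` P ` S \<in> sets borel"
      using S measurable_sets[of Q borel borel] unfolding GS by (auto simp: image_P)
    show "(?G has_derivative ?G' y) (at y within P ` S)" if "y \<in> P ` S" for y
    proof -
      have "Q y \<in> S" and QS: "Q ` P ` S = S"
        using that by (auto simp: image_image)
      then have "(g has_derivative g' (Q y)) (at (Q y) within Q ` P ` S)"
        using der by simp
      from diff_chain_within[OF bounded_linear_imp_has_derivative[OF Q_lin] this]
        and bounded_linear_imp_has_derivative[OF P_lin]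
      show ?thesis
        unfolding comp_assoc by (rule diff_chain_within)
    qed
    show "inj_on ?G (P ` S)"
      using inj by (auto simp: inj_on_def) (metis QP)
    show "0 \<le> f (Q y)" if "y \<in> ?G ` P ` S" for y
      using that f_nonneg by auto
    show "set_borel_measurable borel (?G ` P ` S) (\<lambda>y. f (Q y))"
      unfolding GS by (rule measurable_Q[OF f_meas])
    show "set_borel_measurable borel (P ` S) (\<lambda>x. \<bar>det (matrix (?G' x))\<bar> * f (Q (?G x)))"
      using measurable_Q[OF D_meas] by (simp only: det) simp
  qed
  also have "\<dots> = (\<integral>\<^sup>+x\<in>S. ennreal (\<bar>det (matrix (g' x))\<bar> * f (g x)) \<partial>lborel)"
    using transfer[OF S(1) measurable_ennreal[OF D_meas]] by (simp only: det) simp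
  finally show ?thesis .
qed

section \<open>Quadratic forms and the classes \<open>C\<^sup>k\<close>\<close>

text \<open>The segment from the identity to \<open>G\<close> consists of positive definite, hence invertible, matrices, so
  the determinant keeps the sign it has at the identity.\<close>

lemma det_positive_definite:
  fixes G :: "real ^ 'n::finite ^ 'n"
  assumes pos: "\<And>v. v \<noteq> 0 \<Longrightarrow> v \<bullet> (G *v v) > 0"
  shows "det G > 0"
proof -
  define H where "H s = (1 - s) *\<^sub>R mat 1 + s *\<^sub>R G" for s :: real
  have "det (H s) \<noteq> 0" if s: "s \<in> {0..1}" for s
  proof
    assume "det (H s) = 0"
    then obtain v where v: "v \<noteq> 0" "H s *v v = 0"
      by (metis invertible_det_nz invertible_left_inverse matrix_left_invertible_ker)
    then have "(1 - s) * (v \<bullet> v) + s * (v \<bullet> (G *v v)) = 0"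
      by (metis (no_types, lifting) H_def inner_add_right inner_scaleR_right inner_zero_right
          matrix_vector_mul_lid matrix_vector_mult_add_rdistrib scaleR_matrix_vector_assoc)
    moreover have "(1 - s) * (v \<bullet> v) \<ge> 0" "s * (v \<bullet> (G *v v)) \<ge> 0" "v \<bullet> v > 0" "v \<bullet> (G *v v) > 0"
      using s v pos[of v] by auto
    ultimately show False
      using s by (cases "s = 0") (auto simp: add_nonneg_eq_0_iff)
  qed
  moreover have cont: "continuous_on {0..1} (\<lambda>s. det (H s))"
    unfolding det_def H_def by (intro continuous_intros)
  ultimately have "\<not> det (H 1) \<le> 0"
    using IVT2'[of "\<lambda>s. det (H s)" 1 0 0] by (auto simp: H_def)
  then show ?thesis
    by (simp add: H_def)
qed

lemma Ck_on_imp_continuous_on: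
  assumes "Ck_on k f S"
  shows "continuous_on S f"
proof (cases k)
  case (Suc j)
  then show ?thesis
    using assms by (intro differentiable_imp_continuous_on differentiable_at_imp_differentiable_on) auto
qed (use assms in simp)

lemma bilinear_form_eq_matrix:
  fixes h :: "real ^ 'n::finite \<Rightarrow> real ^ 'n \<Rightarrow> real"
  assumes "\<And>w. linear (\<lambda>u. h u w)" and "\<And>u. linear (h u)"
  shows "h u w = u \<bullet> ((\<chi> i j. h (axis i 1) (axis j 1)) *v w)"
proof -
  have expand: "f x = (\<Sum>i\<in>UNIV. x $ i * f (axis i 1))" if "linear f" for f :: "real ^ 'n \<Rightarrow> real" and x
  proof -
    have "f x = f (\<Sum>i\<in>UNIV. x $ i *\<^sub>R axis i 1)"
      using basis_expansion[of x] by (simp add: scalar_mult_eq_scaleR)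
    then show ?thesis
      using that by (simp add: linear_sum linear_scale)
  qed
  have "h u w = (\<Sum>i\<in>UNIV. u $ i * h (axis i 1) w)"
    by (rule expand[OF assms(1)])
  also have "\<dots> = (\<Sum>i\<in>UNIV. u $ i * (\<Sum>j\<in>UNIV. w $ j * h (axis i 1) (axis j 1)))"
    using expand[OF assms(2)] by metis
  finally show ?thesis
    by (simp add: inner_vec_def matrix_vector_mult_def mult.commute)
qed

lemma continuous_on_matrix_vector_mult [continuous_intros]:
  fixes F :: "'a::topological_space \<Rightarrow> real ^ 'n::finite ^ 'm::finite"
  assumes "continuous_on S F" "continuous_on S u"
  shows "continuous_on S (\<lambda>x. F x *v u x)"
  unfolding matrix_vector_mult_def using assms by (intro continuous_intros)

section \<open>Charts, transition maps and tangent vectors\<close>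

locale smooth_manifold =
  fixes M :: "'m::t2_space set" and A :: "('m, 'n::finite) chart set"
  assumes smooth_atlas: "smooth_atlas M A"
begin

abbreviation chart_img :: "('m, 'n) chart \<Rightarrow> (real ^ 'n) set" where
  "chart_img c \<equiv> chart_map c ` chart_dom c"

lemma is_chart: "c \<in> A \<Longrightarrow> is_chart M c"
  using smooth_atlas by (simp add: smooth_atlas_def)

lemma openin_chart_dom: "c \<in> A \<Longrightarrow> openin (top_of_set M) (chart_dom c)"
  and open_chart_img: "c \<in> A \<Longrightarrow> open (chart_img c)"
  and homeomorphism_chart: "c \<in> A \<Longrightarrow> homeomorphism (chart_dom c) (chart_img c) (chart_map c) (chart_inv c)"
  using is_chart by (auto simp: is_chart_def)

lemma chart_dom_subset: "c \<in> A \<Longrightarrow> chart_dom c \<subseteq> M"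
  using openin_chart_dom openin_imp_subset by blast

lemma chart_dom_in_M: "c \<in> A \<Longrightarrow> x \<in> chart_dom c \<Longrightarrow> x \<in> M"
  using chart_dom_subset by blast

lemma charts_at_iff: "c \<in> charts_at A x \<longleftrightarrow> c \<in> A \<and> x \<in> chart_dom c"
  by (simp add: charts_at_def)

lemma chart_inv_chart_map [simp]: "c \<in> A \<Longrightarrow> x \<in> chart_dom c \<Longrightarrow> chart_inv c (chart_map c x) = x"
  and chart_map_chart_inv [simp]: "c \<in> A \<Longrightarrow> z \<in> chart_img c \<Longrightarrow> chart_map c (chart_inv c z) = z"
  and chart_inv_in_dom [simp]: "c \<in> A \<Longrightarrow> z \<in> chart_img c \<Longrightarrow> chart_inv c z \<in> chart_dom c"
  and continuous_on_chart_map: "c \<in> A \<Longrightarrow> continuous_on (chart_dom c) (chart_map c)"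
  and continuous_on_chart_inv: "c \<in> A \<Longrightarrow> continuous_on (chart_img c) (chart_inv c)"
  using homeomorphism_chart[of c] by (auto simp: homeomorphism_def)

lemma ex_chart:
  assumes "x \<in> M"
  obtains c where "c \<in> A" "x \<in> chart_dom c"
  using assms smooth_atlas by (auto simp: smooth_atlas_def)

lemma open_chart_image:
  assumes "c \<in> A" "openin (top_of_set M) U"
  shows "open (chart_map c ` (chart_dom c \<inter> U))"
proof -
  obtain T where T: "open T" "U = M \<inter> T"
    using assms(2) by (auto simp: openin_open)
  have "chart_map c ` (chart_dom c \<inter> U) = chart_inv c -` T \<inter> chart_img c"
    using assms(1) chart_dom_subset[of c] T(2) by auto
  then show ?thesis
    using continuous_open_preimage[OF continuous_on_chart_inv open_chart_img T(1)] assms(1)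
    by (simp add: Int_commute)
qed

lemma open_overlap:
  "c \<in> A \<Longrightarrow> c' \<in> A \<Longrightarrow> open (chart_map c ` (chart_dom c \<inter> chart_dom c'))"
  by (intro open_chart_image openin_chart_dom)

lemma Ck_transition:
  "c \<in> A \<Longrightarrow> c' \<in> A \<Longrightarrow> Ck_on k (transition c c') (chart_map c ` (chart_dom c \<inter> chart_dom c'))"
  using smooth_atlas by (simp add: smooth_atlas_def)

lemma transition_chart_map [simp]:
  "c \<in> A \<Longrightarrow> x \<in> chart_dom c \<Longrightarrow> transition c c' (chart_map c x) = chart_map c' x"
  by (simp add: transition_def)

lemma transition_has_derivative:
  assumes "c \<in> A" "c' \<in> A" "z \<in> chart_map c ` (chart_dom c \<inter> chart_dom c')"
  shows "(transition c c' has_derivative frechet_derivative (transition c c') (at z)) (at z)"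
  using Ck_transition[OF assms(1,2), of "Suc 0"] assms(3)
  by (metis Ck_on.simps(2) frechet_derivative_works)

lemma continuous_on_transition_derivative:
  assumes "c \<in> A" "c' \<in> A"
  shows "continuous_on (chart_map c ` (chart_dom c \<inter> chart_dom c'))
    (\<lambda>z. frechet_derivative (transition c c') (at z) v)"
  using Ck_transition[OF assms(1,2), of "Suc 0"] by simp

abbreviation transition_diff :: "('m, 'n) chart \<Rightarrow> ('m, 'n) chart \<Rightarrow> 'm \<Rightarrow> real ^ 'n \<Rightarrow> real ^ 'n" where
  "transition_diff c c' x \<equiv> frechet_derivative (transition c c') (at (chart_map c x))"

lemma transition_diff_has_derivative:
  assumes "c \<in> charts_at A x" "c' \<in> charts_at A x"
  shows "(transition c c' has_derivative transition_diff c c' x) (at (chart_map c x))"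
  using assms by (intro transition_has_derivative) (auto simp: charts_at_def)

lemma linear_transition_diff:
  assumes "c \<in> charts_at A x" "c' \<in> charts_at A x"
  shows "linear (transition_diff c c' x)"
  by (rule has_derivative_linear[OF transition_diff_has_derivative[OF assms]])

lemma transition_diff_self:
  assumes c: "c \<in> charts_at A x"
  shows "transition_diff c c x u = u"
proof -
  have "(transition c c has_derivative (\<lambda>u. u)) (at (chart_map c x))"
    by (rule has_derivative_transform_within_open[OF has_derivative_ident open_chart_img[of c]])
      (use c in \<open>auto simp: charts_at_def\<close>)
  from has_derivative_unique[OF this transition_diff_has_derivative[OF c c]] show ?thesis
    by metis
qed

text \<open>The cocycle rule, which makes tangent vectors well defined: each one is
  determined by its coordinates in a single chart, and these are arbitrary.\<close>

lemma transition_diff_compose: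
  assumes c: "c \<in> charts_at A x" "c' \<in> charts_at A x" "c'' \<in> charts_at A x"
  shows "transition_diff c c'' x u = transition_diff c' c'' x (transition_diff c c' x u)"
proof -
  have x: "c \<in> A" "c' \<in> A" "x \<in> chart_dom c" "x \<in> chart_dom c'"
    using c by (auto simp: charts_at_def)
  have "(transition c' c'' has_derivative transition_diff c' c'' x) (at (transition c c' (chart_map c x)))"
    using transition_diff_has_derivative[OF c(2,3)] x by simp
  from diff_chain_at[OF transition_diff_has_derivative[OF c(1,2)] this]
  have "(transition c c'' has_derivative transition_diff c' c'' x \<circ> transition_diff c c' x) (at (chart_map c x))"
    by (rule has_derivative_transform_within_open[OF _ open_overlap[of c c']])
      (use x in \<open>auto simp: transition_def\<close>)
  from has_derivative_unique[OF this transition_diff_has_derivative[OF c(1,3)]] show ?thesis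
    by (metis comp_apply)
qed

lemma tangent_of_in_tangent_space:
  assumes "c \<in> charts_at A x"
  shows "tangent_of A c x u \<in> tangent_space A x"
  using assms by (simp add: tangent_space_def tangent_of_def transition_diff_compose[symmetric])

lemma tangent_of_self [simp]: "c \<in> charts_at A x \<Longrightarrow> tangent_of A c x u c = u"
  by (simp add: tangent_of_def transition_diff_self)

lemma tangent_of_coords:
  assumes "v \<in> tangent_space A x" "c \<in> charts_at A x"
  shows "tangent_of A c x (v c) = v"
proof
  fix c'
  show "tangent_of A c x (v c) c' = v c'"
  proof (cases "c' \<in> charts_at A x")
    case True
    then have "v c' = transition_diff c c' x (v c)"
      using assms unfolding tangent_space_def by blast
    with True show ?thesis
      by (simp only: tangent_of_def if_True)
  next
    case False
    then have "v c' = 0"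
      using assms(1) unfolding tangent_space_def by blast
    with False show ?thesis
      by (simp add: tangent_of_def)
  qed
qed

end

section \<open>Riemannian metrics in coordinates\<close>

locale riemannian_manifold = smooth_manifold M A
  for M :: "'m::t2_space set" and A :: "('m, 'n::finite) chart set" +
  fixes g :: "('m, 'n) metric" and k :: nat
  assumes metric: "riemannian_metric k M A g"
begin

lemma metric_add: "x \<in> M \<Longrightarrow> u \<in> tangent_space A x \<Longrightarrow> v \<in> tangent_space A x \<Longrightarrow> w \<in> tangent_space A x
    \<Longrightarrow> g x (\<lambda>c. u c + v c) w = g x u w + g x v w"
  and metric_scale: "x \<in> M \<Longrightarrow> v \<in> tangent_space A x \<Longrightarrow> w \<in> tangent_space A x
    \<Longrightarrow> g x (\<lambda>c. a *\<^sub>R v c) w = a * g x v w"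
  and metric_commute: "x \<in> M \<Longrightarrow> v \<in> tangent_space A x \<Longrightarrow> w \<in> tangent_space A x \<Longrightarrow> g x v w = g x w v"
  and metric_pos: "x \<in> M \<Longrightarrow> v \<in> tangent_space A x \<Longrightarrow> v \<noteq> (\<lambda>_. 0) \<Longrightarrow> g x v v > 0"
  and Ck_gram: "c \<in> A \<Longrightarrow> Ck_on k (\<lambda>z. gram A g c z $ i $ j) (chart_img c)"
  using metric unfolding riemannian_metric_def by auto

text \<open>In a chart the metric is the bilinear form of its Gram matrix, so that all that follows can be
  done with matrices.\<close>

lemma metric_tangent_of:
  assumes c: "c \<in> A" "x \<in> chart_dom c"
  shows "g x (tangent_of A c x u) (tangent_of A c x w) = u \<bullet> (gram A g c (chart_map c x) *v w)"
proof -
  let ?h = "\<lambda>u w. g x (tangent_of A c x u) (tangent_of A c x w)"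
  have x: "x \<in> M" and cx: "c \<in> charts_at A x"
    using c chart_dom_in_M by (simp_all add: charts_at_iff)
  note tan = tangent_of_in_tangent_space[OF cx]
  have add: "tangent_of A c x (u + v) = (\<lambda>c'. tangent_of A c x u c' + tangent_of A c x v c')"
    and scale: "tangent_of A c x (a *\<^sub>R u) = (\<lambda>c'. a *\<^sub>R tangent_of A c x u c')" for u v a
    using linear_add[OF linear_transition_diff[OF cx]] linear_scale[OF linear_transition_diff[OF cx]]
    by (auto simp: tangent_of_def fun_eq_iff)
  have lin: "linear (\<lambda>u. ?h u w)" for w
    by (intro linearI) (simp_all add: add scale metric_add metric_scale x tan)
  moreover have "linear (?h u)" for u
    using lin[of u] metric_commute[OF x tan tan] by presburger
  ultimately have "?h u w = u \<bullet> ((\<chi> i j. ?h (axis i 1) (axis j 1)) *v w)"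
    by (rule bilinear_form_eq_matrix)
  then show ?thesis
    using c by (simp add: gram_def)
qed

lemma metric_eq_gram:
  assumes "c \<in> A" "x \<in> chart_dom c" "v \<in> tangent_space A x" "w \<in> tangent_space A x"
  shows "g x v w = v c \<bullet> (gram A g c (chart_map c x) *v w c)"
proof -
  have "c \<in> charts_at A x"
    using assms by (simp add: charts_at_def)
  then show ?thesis
    using metric_tangent_of[of c x "v c" "w c"] assms by (simp add: tangent_of_coords)
qed

lemma gram_pos:
  assumes "c \<in> A" "z \<in> chart_img c" "v \<noteq> 0"
  shows "v \<bullet> (gram A g c z *v v) > 0"
proof -
  obtain x where x: "x \<in> chart_dom c" "z = chart_map c x"
    using assms by auto
  then have c: "c \<in> charts_at A x" "x \<in> M"
    using assms chart_dom_in_M by (simp_all add: charts_at_iff)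
  have "tangent_of A c x v \<noteq> (\<lambda>_. 0)"
    using tangent_of_self[OF c(1), of v] assms(3) by metis
  with metric_pos[OF c(2) tangent_of_in_tangent_space[OF c(1)], of v]
  show ?thesis
    using metric_tangent_of[OF assms(1) x(1), of v v] x(2) by simp
qed

lemma gram_nonneg: "c \<in> A \<Longrightarrow> z \<in> chart_img c \<Longrightarrow> v \<bullet> (gram A g c z *v v) \<ge> 0"
  using gram_pos[of c z v] by (cases "v = 0") auto

lemma gram_commute:
  assumes "c \<in> A" "z \<in> chart_img c"
  shows "u \<bullet> (gram A g c z *v w) = w \<bullet> (gram A g c z *v u)"
proof -
  obtain x where x: "x \<in> chart_dom c" "z = chart_map c x"
    using assms by auto
  then have c: "c \<in> charts_at A x" "x \<in> M"
    using assms chart_dom_in_M by (simp_all add: charts_at_iff)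
  show ?thesis
    using metric_commute[OF c(2) tangent_of_in_tangent_space[OF c(1), of u] tangent_of_in_tangent_space[OF c(1), of w]]
    by (simp add: metric_tangent_of assms(1) x)
qed

lemma continuous_on_gram: "c \<in> A \<Longrightarrow> continuous_on (chart_img c) (gram A g c)"
  unfolding gram_def
  by (intro continuous_on_vec_lambda Ck_on_imp_continuous_on[OF Ck_gram, of c, unfolded gram_def vec_lambda_beta])

lemma det_gram_pos: "c \<in> A \<Longrightarrow> z \<in> chart_img c \<Longrightarrow> det (gram A g c z) > 0"
  by (intro det_positive_definite gram_pos)

text \<open>The Gram matrix transforms as a covariant tensor under the transition maps.\<close>

lemma gram_transition:
  assumes "c \<in> A" "c' \<in> A" "x \<in> chart_dom c" "x \<in> chart_dom c'"
  shows "u \<bullet> (gram A g c (chart_map c x) *v w)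
    = transition_diff c c' x u \<bullet> (gram A g c' (chart_map c' x) *v transition_diff c c' x w)"
proof -
  have c: "c \<in> charts_at A x" "c' \<in> charts_at A x"
    using assms by (auto simp: charts_at_def)
  have "tangent_of A c x u c' = transition_diff c c' x u" for u
    using c by (simp add: tangent_of_def)
  then show ?thesis
    using metric_tangent_of[OF assms(1,3), of u w]
      metric_eq_gram[OF assms(2,4) tangent_of_in_tangent_space[OF c(1), of u] tangent_of_in_tangent_space[OF c(1), of w]]
    by simp
qed

text \<open>The tensor law reads \<open>G = J\<^sup>T G' J\<close>. Taking determinants gives exactly
  the factor that occurs in the change of variables formula, so that the volume density
  is independent of the chart.\<close>

lemma sqrt_det_gram_transition:
  assumes "c \<in> A" "c' \<in> A" "x \<in> chart_dom c" "x \<in> chart_dom c'"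
  shows "sqrt (det (gram A g c (chart_map c x)))
    = \<bar>det (matrix (transition_diff c c' x))\<bar> * sqrt (det (gram A g c' (chart_map c' x)))"
proof -
  let ?J = "matrix (transition_diff c c' x)"
  let ?G = "gram A g c (chart_map c x)" and ?G' = "gram A g c' (chart_map c' x)"
  have "transition_diff c c' x u = ?J *v u" for u
    using linear_transition_diff[of c x c'] assms by (simp add: charts_at_iff)
  moreover have "(?J *v u) \<bullet> y = u \<bullet> (transpose ?J *v y)" for u y
    by (metis dot_lmul_matrix inner_commute transpose_matrix_vector)
  ultimately have "u \<bullet> (?G *v w) = u \<bullet> ((transpose ?J ** ?G' ** ?J) *v w)" for u w
    using gram_transition[OF assms, of u w]
    by (simp add: matrix_vector_mul_assoc[symmetric])
  then have "?G *v w = (transpose ?J ** ?G' ** ?J) *v w" for w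
    using vector_eq_ldot by blast
  then have "?G = transpose ?J ** ?G' ** ?J"
    using matrix_eq by blast
  then have "det ?G = (det ?J)\<^sup>2 * det ?G'"
    by (simp add: det_mul power2_eq_square)
  then show ?thesis
    by (simp add: real_sqrt_mult)
qed

end

section \<open>Piecewise \<open>C\<^sup>1\<close> curves and their lengths\<close>

context smooth_manifold
begin

definition C1_path :: "real \<Rightarrow> real \<Rightarrow> (real \<Rightarrow> 'm) \<Rightarrow> bool" where
  "C1_path a b \<gamma> \<longleftrightarrow> a < b \<and> continuous_on {a..b} \<gamma> \<and> \<gamma> ` {a..b} \<subseteq> M \<and> C1_curve_on A a b \<gamma>"

text \<open>The parameter interval is arbitrary, because curves are cut into pieces and concatenated below.\<close>

definition pw_C1_path :: "real \<Rightarrow> real \<Rightarrow> (real \<Rightarrow> 'm) \<Rightarrow> bool" where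
  "pw_C1_path a b \<gamma> \<longleftrightarrow> continuous_on {a..b} \<gamma> \<and> \<gamma> ` {a..b} \<subseteq> M \<and>
     (\<exists>(N::nat) \<tau>. \<tau> 0 = a \<and> \<tau> N = b \<and> (\<forall>i<N. \<tau> i < \<tau> (Suc i) \<and> C1_curve_on A (\<tau> i) (\<tau> (Suc i)) \<gamma>))"

lemma piecewise_C1_curve_iff: "piecewise_C1_curve M A \<gamma> \<longleftrightarrow> pw_C1_path 0 1 \<gamma>"
  by (simp add: piecewise_C1_curve_def pw_C1_path_def)

text \<open>Unlike \<open>velocity\<close>, this is meaningful at the end points of a \<open>C\<^sup>1\<close> piece on the interval \<open>T\<close>, and
  it makes the speed continuous on the whole closed piece.\<close>

definition velocity_within :: "real set \<Rightarrow> (real \<Rightarrow> 'm) \<Rightarrow> real \<Rightarrow> ('m, 'n) tangent" where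
  "velocity_within T \<gamma> s =
     (\<lambda>c. if c \<in> charts_at A (\<gamma> s) then vector_derivative (chart_map c \<circ> \<gamma>) (at s within T) else 0)"

lemma C1_path_derivative:
  assumes \<gamma>: "C1_path a b \<gamma>" and s: "s \<in> {a..b}" and c: "c \<in> charts_at A (\<gamma> s)"
  shows "((chart_map c \<circ> \<gamma>) has_vector_derivative velocity_within {a..b} \<gamma> s c) (at s within {a..b})"
proof -
  obtain D where "((chart_map c \<circ> \<gamma>) has_vector_derivative D s) (at s within {a..b})"
    using \<gamma> s c unfolding C1_path_def C1_curve_on_def charts_at_iff by blast
  then show ?thesis
    using c by (simp add: velocity_within_def vector_derivative_works[symmetric] differentiableI_vector)
qed

lemma openin_chart_preimage:
  assumes "continuous_on S \<gamma>" "\<gamma> ` S \<subseteq> M" "c \<in> A"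
  shows "openin (top_of_set S) {s \<in> S. \<gamma> s \<in> chart_dom c}"
proof -
  have "openin (top_of_set S) (S \<inter> \<gamma> -` chart_dom c)"
    using assms(1,2) openin_chart_dom[OF assms(3)]
    by (intro continuous_openin_preimage[where T = M]) (auto simp: image_subset_iff)
  then show ?thesis
    by (simp add: Int_def vimage_def)
qed

lemma continuous_on_velocity_within:
  assumes \<gamma>: "C1_path a b \<gamma>" and c: "c \<in> A"
  shows "continuous_on {s \<in> {a..b}. \<gamma> s \<in> chart_dom c} (\<lambda>s. velocity_within {a..b} \<gamma> s c)"
proof -
  let ?S = "{s \<in> {a..b}. \<gamma> s \<in> chart_dom c}"
  obtain D where D: "\<And>s. s \<in> ?S \<Longrightarrow> ((chart_map c \<circ> \<gamma>) has_vector_derivative D s) (at s within {a..b})"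
    and cont: "continuous_on ?S D"
    using \<gamma> c unfolding C1_path_def C1_curve_on_def by blast
  have eq: "D s = velocity_within {a..b} \<gamma> s c" if "s \<in> ?S" for s
    using C1_path_derivative[OF \<gamma>, of s c] D[OF that] that c \<gamma>
    by (intro vector_derivative_unique_within_closed_interval[of a b s "chart_map c \<circ> \<gamma>"])
      (auto simp: charts_at_iff C1_path_def)
  show ?thesis
    by (rule continuous_on_eq[OF cont eq])
qed

text \<open>The chain rule for the transition maps.\<close>

lemma velocity_within_tangent:
  assumes \<gamma>: "C1_path a b \<gamma>" and s: "s \<in> {a..b}"
  shows "velocity_within {a..b} \<gamma> s \<in> tangent_space A (\<gamma> s)"
proof -
  let ?T = "{a..b}" and ?v = "velocity_within {a..b} \<gamma> s"
  have "?v c' = transition_diff c c' (\<gamma> s) (?v c)"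
    if c: "c \<in> charts_at A (\<gamma> s)" and c': "c' \<in> charts_at A (\<gamma> s)" for c c'
  proof -
    have cA: "c \<in> A" "\<gamma> s \<in> chart_dom c"
      using c by (auto simp: charts_at_iff)
    have "((chart_map c \<circ> \<gamma>) has_derivative (\<lambda>h. h *\<^sub>R ?v c)) (at s within ?T)"
      using C1_path_derivative[OF \<gamma> s c] by (simp add: has_vector_derivative_def)
    moreover have "(transition c c' has_derivative transition_diff c c' (\<gamma> s))
        (at ((chart_map c \<circ> \<gamma>) s) within (chart_map c \<circ> \<gamma>) ` ?T)"
      using transition_diff_has_derivative[OF c c'] by (simp add: has_derivative_at_withinI)
    ultimately have "(transition c c' \<circ> (chart_map c \<circ> \<gamma>) has_derivative
        transition_diff c c' (\<gamma> s) \<circ> (\<lambda>h. h *\<^sub>R ?v c)) (at s within ?T)"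
      by (rule diff_chain_within)
    moreover have "transition_diff c c' (\<gamma> s) \<circ> (\<lambda>h. h *\<^sub>R ?v c) = (\<lambda>h. h *\<^sub>R transition_diff c c' (\<gamma> s) (?v c))"
      using linear_scale[OF linear_transition_diff[OF c c']] by auto
    ultimately have deriv: "(transition c c' \<circ> (chart_map c \<circ> \<gamma>) has_vector_derivative
        transition_diff c c' (\<gamma> s) (?v c)) (at s within ?T)"
      by (simp add: has_vector_derivative_def)
    obtain e where e: "e > 0" "ball s e \<inter> ?T \<subseteq> {r \<in> ?T. \<gamma> r \<in> chart_dom c}"
      using openin_chart_preimage[of ?T \<gamma> c] \<gamma> cA s unfolding C1_path_def openin_contains_ball by blast
    from deriv have "((chart_map c' \<circ> \<gamma>) has_vector_derivative
        transition_diff c c' (\<gamma> s) (?v c)) (at s within ?T)"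
      by (rule has_vector_derivative_transform_within)
        (use e s cA in \<open>auto simp: subset_iff dist_commute\<close>)
    then show ?thesis
      using C1_path_derivative[OF \<gamma> s c'] \<gamma> s
      by (intro vector_derivative_unique_within_closed_interval[of a b s "chart_map c' \<circ> \<gamma>"])
        (auto simp: C1_path_def)
  qed
  moreover have "?v c = 0" if "c \<notin> charts_at A (\<gamma> s)" for c
    using that by (simp add: velocity_within_def)
  ultimately show ?thesis
    unfolding tangent_space_def by blast
qed

text \<open>At all but finitely many parameters of an admissible curve the two-sided velocity is a genuine
  tangent vector, so statements about lengths only need to consider these parameters.\<close>

definition regular_at :: "(real \<Rightarrow> 'm) \<Rightarrow> real \<Rightarrow> bool" where
  "regular_at \<gamma> s \<longleftrightarrow> \<gamma> s \<in> M \<and> velocity A \<gamma> s \<in> tangent_space A (\<gamma> s) \<and>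
     (\<forall>c\<in>charts_at A (\<gamma> s). ((chart_map c \<circ> \<gamma>) has_vector_derivative velocity A \<gamma> s c) (at s))"

lemma velocity_eq_velocity_within:
  assumes "s \<in> {a<..<b}"
  shows "velocity A \<gamma> s = velocity_within {a..b} \<gamma> s"
  using assms by (simp add: velocity_def velocity_within_def at_within_Icc_at fun_eq_iff)

lemma C1_path_regular:
  assumes \<gamma>: "C1_path a b \<gamma>" and s: "s \<in> {a<..<b}"
  shows "regular_at \<gamma> s"
proof -
  have "s \<in> {a..b}"
    using s by simp
  then show ?thesis
    using \<gamma> s C1_path_derivative[OF \<gamma>, of s] velocity_within_tangent[OF \<gamma>, of s]
    by (auto simp: regular_at_def velocity_eq_velocity_within[OF s] at_within_Icc_at C1_path_def)
qed

lemma pw_C1_path_split: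
  assumes "pw_C1_path a b \<gamma>"
  obtains N \<tau> where "\<tau> 0 = a" "\<tau> N = b" "\<And>i. i < N \<Longrightarrow> C1_path (\<tau> i) (\<tau> (Suc i)) \<gamma>"
    "\<And>i. i \<le> N \<Longrightarrow> a \<le> \<tau> i" "\<And>i. i \<le> N \<Longrightarrow> \<tau> i \<le> b"
proof -
  obtain N \<tau> where *: "\<tau> 0 = a" "\<tau> (N::nat) = b"
    "\<And>i. i < N \<Longrightarrow> \<tau> i < \<tau> (Suc i) \<and> C1_curve_on A (\<tau> i) (\<tau> (Suc i)) \<gamma>"
    using assms unfolding pw_C1_path_def by blast
  have lower: "a \<le> \<tau> i" if "i \<le> N" for i
    using that
  proof (induction i)
    case (Suc i)
    then show ?case
      using *(3)[of i] by simp
  qed (simp add: *(1))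
  have "\<tau> (N - i) \<le> b" for i
  proof (induction i)
    case (Suc i)
    show ?case
    proof (cases "i < N")
      case True
      then show ?thesis
        using *(3)[of "N - Suc i"] Suc by (simp add: Suc_diff_Suc)
    next
      case False
      then show ?thesis using Suc by simp
    qed
  qed (simp add: *(2))
  then have upper: "\<tau> i \<le> b" if "i \<le> N" for i
    using that diff_diff_cancel by metis
  have "C1_path (\<tau> i) (\<tau> (Suc i)) \<gamma>" if i: "i < N" for i
  proof -
    have "{\<tau> i..\<tau> (Suc i)} \<subseteq> {a..b}"
      using lower[of i] upper[of "Suc i"] i by auto
    then show ?thesis
      using assms *(3)[OF i] continuous_on_subset unfolding C1_path_def pw_C1_path_def
      by (meson image_mono subset_trans)
  qed
  then show ?thesis
    using that[of \<tau> N] *(1,2) lower upper by auto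
qed

lemma pw_C1_path_le: "pw_C1_path a b \<gamma> \<Longrightarrow> a \<le> b"
  by (metis pw_C1_path_split order_refl)

lemma pw_C1_path_regular:
  assumes "pw_C1_path a b \<gamma>"
  obtains K where "finite K" "\<And>s. s \<in> {a..b} - K \<Longrightarrow> regular_at \<gamma> s"
proof -
  obtain N \<tau> where \<tau>: "\<tau> 0 = a" "\<tau> N = b" "\<And>i. i < N \<Longrightarrow> C1_path (\<tau> i) (\<tau> (Suc i)) \<gamma>"
    using pw_C1_path_split[OF assms] by metis
  have "regular_at \<gamma> s" if "s \<in> {a..\<tau> i} - \<tau> ` {..N}" "i \<le> N" for s i
    using that
  proof (induction i)
    case (Suc i)
    show ?case
    proof (cases "s \<le> \<tau> i")
      case False
      then have "s \<in> {\<tau> i<..<\<tau> (Suc i)}"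
        using Suc.prems by (auto simp: less_le)
      then show ?thesis
        using \<tau>(3)[of i] C1_path_regular Suc.prems by auto
    qed (use Suc in auto)
  qed (use \<tau>(1) in auto)
  from this[of _ N] show ?thesis
    using that[of "\<tau> ` {..N}"] \<tau>(2) by auto
qed

end

context riemannian_manifold
begin

definition speed :: "(real \<Rightarrow> 'm) \<Rightarrow> real \<Rightarrow> real" where
  "speed \<gamma> s = sqrt (g (\<gamma> s) (velocity A \<gamma> s) (velocity A \<gamma> s))"

lemma curve_length_eq: "curve_length A g \<gamma> = integral {0..1} (speed \<gamma>)"
  by (simp add: curve_length_def speed_def[abs_def])

lemma regular_speed_eq:
  assumes "regular_at \<gamma> s" "c \<in> charts_at A (\<gamma> s)"
  shows "speed \<gamma> s = sqrt (velocity A \<gamma> s c \<bullet> (gram A g c (chart_map c (\<gamma> s)) *v velocity A \<gamma> s c))"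
  using assms metric_eq_gram[of c "\<gamma> s"] by (simp add: speed_def regular_at_def charts_at_iff)

lemma regular_speed_nonneg: "regular_at \<gamma> s \<Longrightarrow> 0 \<le> speed \<gamma> s"
  using ex_chart[of "\<gamma> s"] regular_speed_eq[of \<gamma> s] gram_nonneg
  by (metis charts_at_iff imageI real_sqrt_ge_zero regular_at_def)

text \<open>The speed in terms of one-sided velocities is continuous, because near each parameter it
  can be computed in a fixed chart.\<close>

lemma C1_path_speed_integrable:
  assumes \<gamma>: "C1_path a b \<gamma>"
  shows "speed \<gamma> integrable_on {a..b}"
proof -
  let ?v = "velocity_within {a..b} \<gamma>"
  let ?f = "\<lambda>s. sqrt (g (\<gamma> s) (?v s) (?v s))"
  have "continuous (at s within {a..b}) ?f" if s: "s \<in> {a..b}" for s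
  proof -
    have "\<gamma> s \<in> M"
      using s \<gamma> by (auto simp: C1_path_def)
    then obtain c where c: "c \<in> A" "\<gamma> s \<in> chart_dom c"
      by (rule ex_chart)
    let ?S = "{s \<in> {a..b}. \<gamma> s \<in> chart_dom c}"
    have eq: "sqrt (?v r c \<bullet> (gram A g c (chart_map c (\<gamma> r)) *v ?v r c)) = ?f r" if "r \<in> ?S" for r
      using that c metric_eq_gram[of c "\<gamma> r"] velocity_within_tangent[OF \<gamma>, of r] by simp
    have cont: "continuous_on ?S (\<lambda>r. sqrt (?v r c \<bullet> (gram A g c (chart_map c (\<gamma> r)) *v ?v r c)))"
    proof -
      have "continuous_on ?S (\<lambda>r. chart_map c (\<gamma> r))"
        using \<gamma> c by (intro continuous_on_compose2[OF continuous_on_chart_map])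
          (auto simp: C1_path_def intro: continuous_on_subset)
      then have "continuous_on ?S (\<lambda>r. gram A g c (chart_map c (\<gamma> r)))"
        using c by (intro continuous_on_compose2[OF continuous_on_gram]) auto
      then show ?thesis
        by (intro continuous_intros continuous_on_velocity_within[OF \<gamma> c(1)])
    qed
    have "continuous_on ?S ?f"
      by (rule continuous_on_eq[OF cont eq])
    moreover obtain e where e: "e > 0" "ball s e \<inter> {a..b} \<subseteq> ?S"
      using openin_chart_preimage[of "{a..b}" \<gamma> c] \<gamma> c s unfolding C1_path_def openin_contains_ball by blast
    moreover have "s \<in> ?S"
      using s c by simp
    ultimately have "continuous (at s within ?S) ?f"
      by (simp add: continuous_on_eq_continuous_within)
    moreover have "at s within ?S = at s within {a..b}"
      by (rule at_within_nhd[of _ "ball s e"]) (use e in auto)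
    ultimately show ?thesis
      by simp
  qed
  then have "continuous_on {a..b} ?f"
    by (simp add: continuous_on_eq_continuous_within)
  then have "?f integrable_on {a..b}"
    by (rule integrable_continuous_real)
  then show ?thesis
    by (rule integrable_spike_finite[of "{a, b}", rotated 2])
      (auto simp: speed_def velocity_eq_velocity_within[of _ a b])
qed

lemma pw_C1_path_speed_integrable:
  assumes "pw_C1_path a b \<gamma>"
  shows "speed \<gamma> integrable_on {a..b}"
proof -
  obtain N \<tau> where \<tau>: "\<tau> 0 = a" "\<tau> N = b" "\<And>i. i < N \<Longrightarrow> C1_path (\<tau> i) (\<tau> (Suc i)) \<gamma>"
    "\<And>i. i \<le> N \<Longrightarrow> a \<le> \<tau> i"
    using pw_C1_path_split[OF assms] by blast
  have "speed \<gamma> integrable_on {a..\<tau> i}" if "i \<le> N" for i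
    using that
  proof (induction i)
    case (Suc i)
    show ?case
      by (rule Henstock_Kurzweil_Integration.integrable_combine[where c = "\<tau> i"])
        (use Suc \<tau>(3)[of i] \<tau>(4)[of i] C1_path_speed_integrable[of "\<tau> i" "\<tau> (Suc i)" \<gamma>] in
          \<open>auto simp: C1_path_def\<close>)
  qed (use integrable_on_refl[of "speed \<gamma>" a] in \<open>simp add: \<tau>(1)\<close>)
  then show ?thesis
    using \<tau>(2) by blast
qed

text \<open>At the finitely many irregular parameters the speed can be the root of a negative number, so it is
  replaced by its absolute value.\<close>

lemma pw_C1_path_length_nonneg:
  assumes \<gamma>: "pw_C1_path a b \<gamma>" and sub: "{c..d} \<subseteq> {a..b}"
  shows "0 \<le> integral {c..d} (speed \<gamma>)"
proof -
  obtain K where K: "finite K" "\<And>s. s \<in> {a..b} - K \<Longrightarrow> regular_at \<gamma> s"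
    using pw_C1_path_regular[OF \<gamma>] by metis
  have "(speed \<gamma> has_integral integral {c..d} (speed \<gamma>)) {c..d}"
    using integrable_on_subinterval[OF pw_C1_path_speed_integrable[OF \<gamma>] sub] by (rule integrable_integral)
  moreover have "\<bar>speed \<gamma> s\<bar> = speed \<gamma> s" if "s \<in> {c..d} - K" for s
    using K(2)[of s] regular_speed_nonneg[of \<gamma> s] that sub by auto
  ultimately have "((\<lambda>s. \<bar>speed \<gamma> s\<bar>) has_integral integral {c..d} (speed \<gamma>)) {c..d}"
    by (rule has_integral_spike_finite[OF K(1), rotated])
  then show ?thesis
    by (rule has_integral_nonneg) simp
qed

text \<open>Reparametrization by an increasing affine map scales the velocity by the slope, which the
  substitution rule compensates.\<close>

lemma pw_C1_path_affine:
  assumes \<gamma>: "pw_C1_path a b \<gamma>" and m: "m > 0"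
    and ends: "m * a' + e = a" "m * b' + e = b"
    and \<sigma>: "\<And>s. s \<in> {a'..b'} \<Longrightarrow> \<sigma> s = \<gamma> (m * s + e)"
  shows "pw_C1_path a' b' \<sigma>"
    and "integral {a'..b'} (speed \<sigma>) = integral {a..b} (speed \<gamma>)"
proof -
  let ?\<phi> = "\<lambda>s. m * s + e" and ?\<psi> = "\<lambda>s. (s - e) / m"
  have \<psi>_ends: "?\<psi> a = a'" "?\<psi> b = b'"
    using m ends by (auto simp: field_simps)
  have \<phi>_mem: "?\<phi> s \<in> {?\<phi> p..?\<phi> q}" if "s \<in> {p..q}" for s p q
    using that m by simp
  have cont: "continuous_on {a'..b'} \<sigma>"
  proof -
    have "continuous_on {a'..b'} (\<lambda>s. \<gamma> (?\<phi> s))"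
    proof (rule continuous_on_compose2[of "{a..b}" \<gamma>])
      show "continuous_on {a..b} \<gamma>"
        using \<gamma> by (simp add: pw_C1_path_def)
      show "?\<phi> ` {a'..b'} \<subseteq> {a..b}"
        using \<phi>_mem[of _ a' b'] ends by auto
    qed (intro continuous_intros)
    then show ?thesis
      using \<sigma> by (auto intro: continuous_on_eq)
  qed
  have im: "\<sigma> ` {a'..b'} \<subseteq> M"
    using \<gamma> \<phi>_mem[of _ a' b'] ends by (force simp: \<sigma> pw_C1_path_def)
  obtain N \<tau> where \<tau>: "\<tau> 0 = a" "\<tau> N = b" "\<And>i. i < N \<Longrightarrow> C1_path (\<tau> i) (\<tau> (Suc i)) \<gamma>"
    "\<And>i. i \<le> N \<Longrightarrow> a \<le> \<tau> i" "\<And>i. i \<le> N \<Longrightarrow> \<tau> i \<le> b"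
    using pw_C1_path_split[OF \<gamma>] by metis
  let ?\<tau> = "\<lambda>i. ?\<psi> (\<tau> i)"
  have C1: "C1_curve_on A (?\<tau> i) (?\<tau> (Suc i)) \<sigma>" if i: "i < N" for i
    unfolding C1_curve_on_def
  proof
    fix c assume c: "c \<in> A"
    let ?I = "{?\<tau> i..?\<tau> (Suc i)}" and ?J = "{\<tau> i..\<tau> (Suc i)}"
    obtain D where D: "\<And>s. s \<in> {s \<in> ?J. \<gamma> s \<in> chart_dom c} \<Longrightarrow>
        ((chart_map c \<circ> \<gamma>) has_vector_derivative D s) (at s within ?J)"
      and D_cont: "continuous_on {s \<in> ?J. \<gamma> s \<in> chart_dom c} D"
      using \<tau>(3)[OF i] c unfolding C1_path_def C1_curve_on_def by blast
    have \<phi>I: "?\<phi> ` ?I = ?J"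
      using m by (subst image_affinity_atLeastAtMost) (auto simp: field_simps)
    have \<phi>I_mem: "\<tau> i \<le> ?\<phi> s" "?\<phi> s \<le> \<tau> (Suc i)" if "s \<in> ?I" for s
      using that m by (auto simp: field_simps)
    have I_sub: "?I \<subseteq> {a'..b'}"
      using \<tau>(4)[of i] \<tau>(5)[of "Suc i"] i m by (auto simp: \<psi>_ends[symmetric] field_simps)
    have \<sigma>I: "\<sigma> s = \<gamma> (?\<phi> s)" if "s \<in> ?I" for s
      using that I_sub \<sigma> by blast
    let ?E = "\<lambda>s. m *\<^sub>R D (?\<phi> s)"
    have "((chart_map c \<circ> \<sigma>) has_vector_derivative ?E s) (at s within ?I)"
      if s: "s \<in> {s \<in> ?I. \<sigma> s \<in> chart_dom c}" for s
    proof -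
      have "((chart_map c \<circ> \<gamma>) has_vector_derivative D (?\<phi> s)) (at (?\<phi> s) within ?\<phi> ` ?I)"
        unfolding \<phi>I using s \<sigma>I[of s] \<phi>I_mem[of s] by (intro D) auto
      moreover have "(?\<phi> has_vector_derivative m) (at s within ?I)"
        by (auto intro!: derivative_eq_intros)
      ultimately have "((chart_map c \<circ> \<gamma>) \<circ> ?\<phi> has_vector_derivative ?E s) (at s within ?I)"
        by (rule vector_diff_chain_within[rotated])
      then show ?thesis
        by (rule has_vector_derivative_transform_within[of _ _ _ _ 1]) (use s \<sigma>I in auto)
    qed
    moreover have "continuous_on {s \<in> ?I. \<sigma> s \<in> chart_dom c} ?E"
    proof -
      have "?\<phi> ` {s \<in> ?I. \<sigma> s \<in> chart_dom c} \<subseteq> {s \<in> ?J. \<gamma> s \<in> chart_dom c}"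
        using \<phi>I_mem \<sigma>I by auto
      then have "continuous_on {s \<in> ?I. \<sigma> s \<in> chart_dom c} (\<lambda>s. D (?\<phi> s))"
        by (intro continuous_on_compose2[OF D_cont]) (intro continuous_intros)
      then show ?thesis
        by (intro continuous_intros)
    qed
    ultimately show "\<exists>E. (\<forall>s\<in>{s \<in> ?I. \<sigma> s \<in> chart_dom c}.
        ((chart_map c \<circ> \<sigma>) has_vector_derivative E s) (at s within ?I)) \<and>
        continuous_on {s \<in> ?I. \<sigma> s \<in> chart_dom c} E"
      by (intro exI[of _ ?E] conjI ballI)
  qed
  have less: "?\<tau> i < ?\<tau> (Suc i)" if "i < N" for i
    using \<tau>(3)[OF that] m by (simp add: C1_path_def divide_strict_right_mono)
  show pw: "pw_C1_path a' b' \<sigma>"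
    unfolding pw_C1_path_def
    using cont im less C1 \<tau>(1,2) \<psi>_ends by (intro conjI exI[of _ N] exI[of _ ?\<tau>]) auto
  obtain K where K: "finite K" "\<And>s. s \<in> {a..b} - K \<Longrightarrow> regular_at \<gamma> s"
    using pw_C1_path_regular[OF \<gamma>] by metis
  obtain L where L: "finite L" "\<And>s. s \<in> {a'..b'} - L \<Longrightarrow> regular_at \<sigma> s"
    using pw_C1_path_regular[OF pw] by metis
  \<comment> \<open>Break points of either curve and the end points are excluded.\<close>
  have speed_eq: "speed \<sigma> s = m * speed \<gamma> (?\<phi> s)" if s: "s \<in> {a'..b'} - (L \<union> ?\<psi> ` K \<union> {a', b'})" for s
  proof -
    have \<phi>s: "?\<phi> s \<in> {a..b} - K"
    proof -
      have "?\<psi> (?\<phi> s) = s"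
        using m by simp
      then show ?thesis
        using s \<phi>_mem[of s a' b'] ends by (metis DiffD1 DiffD2 DiffI UnCI imageI)
    qed
    have reg: "regular_at \<sigma> s" "regular_at \<gamma> (?\<phi> s)"
      using s L K \<phi>s by auto
    have eq: "\<sigma> s = \<gamma> (?\<phi> s)"
      using s \<sigma> by simp
    have "\<sigma> s \<in> M"
      using reg by (simp add: regular_at_def)
    then obtain c where c: "c \<in> A" "\<sigma> s \<in> chart_dom c"
      by (rule ex_chart)
    then have c': "c \<in> charts_at A (\<sigma> s)" "c \<in> charts_at A (\<gamma> (?\<phi> s))"
      by (simp_all add: charts_at_iff eq)
    have "((chart_map c \<circ> \<gamma>) has_vector_derivative velocity A \<gamma> (?\<phi> s) c) (at (?\<phi> s))"
      using reg c' by (simp add: regular_at_def)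
    moreover have "(?\<phi> has_vector_derivative m) (at s)"
      by (auto intro!: derivative_eq_intros)
    ultimately have "((chart_map c \<circ> \<gamma>) \<circ> ?\<phi> has_vector_derivative m *\<^sub>R velocity A \<gamma> (?\<phi> s) c) (at s)"
      by (rule vector_diff_chain_at[rotated])
    then have "((chart_map c \<circ> \<sigma>) has_vector_derivative m *\<^sub>R velocity A \<gamma> (?\<phi> s) c) (at s)"
      by (rule has_vector_derivative_transform_within_open[of _ _ _ "{a'<..<b'}"]) (use s \<sigma> in auto)
    moreover have "((chart_map c \<circ> \<sigma>) has_vector_derivative velocity A \<sigma> s c) (at s)"
      using reg c' by (simp add: regular_at_def)
    ultimately have "velocity A \<sigma> s c = m *\<^sub>R velocity A \<gamma> (?\<phi> s) c"
      by (rule vector_derivative_unique_at[rotated])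
    then show ?thesis
      using m by (simp add: regular_speed_eq[OF reg(1) c'(1)] regular_speed_eq[OF reg(2) c'(2)] eq
          matrix_vector_mult_scaleR real_sqrt_mult mult.assoc[symmetric])
  qed
  have "(speed \<gamma> has_integral integral {a..b} (speed \<gamma>)) (cbox a b)"
    using integrable_integral[OF pw_C1_path_speed_integrable[OF \<gamma>]] by simp
  from has_integral_affinity[OF this, of m e]
  have "((\<lambda>s. speed \<gamma> (?\<phi> s)) has_integral integral {a..b} (speed \<gamma>) / m)
      ((\<lambda>x. (1 / m) * x + - e / m) ` {a..b})"
    using m by simp
  also have "(\<lambda>x. (1 / m) * x + - e / m) ` {a..b} = {a'..b'}"
    using m pw_C1_path_le[OF \<gamma>] \<psi>_ends
    by (subst image_affinity_atLeastAtMost) (simp add: diff_divide_distrib)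
  finally have "((\<lambda>s. speed \<gamma> (?\<phi> s)) has_integral integral {a..b} (speed \<gamma>) / m) {a'..b'}" .
  from has_integral_mult_right[OF this, of m]
  have "((\<lambda>s. m * speed \<gamma> (?\<phi> s)) has_integral integral {a..b} (speed \<gamma>)) {a'..b'}"
    using m by simp
  then have "(speed \<sigma> has_integral integral {a..b} (speed \<gamma>)) {a'..b'}"
    by (rule has_integral_spike_finite[where S = "L \<union> ?\<psi> ` K \<union> {a', b'}", rotated 2])
      (use speed_eq K(1) L(1) in auto)
  then show "integral {a'..b'} (speed \<sigma>) = integral {a..b} (speed \<gamma>)"
    by (rule integral_unique)
qed

lemma pw_C1_path_join:
  assumes "pw_C1_path a b \<gamma>" "pw_C1_path b c \<gamma>"
  shows "pw_C1_path a c \<gamma>"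
proof -
  obtain N \<tau> where \<tau>: "\<tau> 0 = a" "\<tau> N = b" "\<And>i. i < N \<Longrightarrow> \<tau> i < \<tau> (Suc i) \<and> C1_curve_on A (\<tau> i) (\<tau> (Suc i)) \<gamma>"
    using assms(1) unfolding pw_C1_path_def by blast
  obtain N' \<tau>' where \<tau>': "\<tau>' 0 = b" "\<tau>' N' = c" "\<And>i. i < N' \<Longrightarrow> \<tau>' i < \<tau>' (Suc i) \<and> C1_curve_on A (\<tau>' i) (\<tau>' (Suc i)) \<gamma>"
    using assms(2) unfolding pw_C1_path_def by blast
  define \<rho> where "\<rho> i = (if i \<le> N then \<tau> i else \<tau>' (i - N))" for i
  have "\<rho> i < \<rho> (Suc i) \<and> C1_curve_on A (\<rho> i) (\<rho> (Suc i)) \<gamma>" if "i < N + N'" for i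
  proof -
    consider "i < N" | "i = N" | "i > N" by linarith
    then show ?thesis
      by cases (use \<tau> \<tau>' that \<tau>'(3)[of "i - N"] in \<open>auto simp: \<rho>_def Suc_diff_le\<close>)
  qed
  moreover have "\<rho> 0 = a" "\<rho> (N + N') = c"
    using \<tau> \<tau>' by (auto simp: \<rho>_def)
  moreover have ab: "a \<le> b" "b \<le> c"
    using assms by (simp_all add: pw_C1_path_le)
  then have "{a..c} = {a..b} \<union> {b..c}"
    by auto
  then have "continuous_on {a..c} \<gamma>" "\<gamma> ` {a..c} \<subseteq> M"
    using assms by (auto simp: pw_C1_path_def intro!: continuous_on_closed_Un)
  ultimately show ?thesis
    unfolding pw_C1_path_def by blast
qed

end

section \<open>Comparing the geodesic distance with coordinate norms\<close>

context riemannian_manifold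
begin

lemma geodesic_dist_le_length:
  "pw_C1_path 0 1 \<gamma> \<Longrightarrow> geodesic_dist M A g (\<gamma> 0) (\<gamma> 1) \<le> ereal (integral {0..1} (speed \<gamma>))"
  unfolding geodesic_dist_def curve_length_eq piecewise_C1_curve_iff by (rule INF_lower) simp

lemma geodesic_dist_greatest:
  assumes "\<And>\<gamma>. pw_C1_path 0 1 \<gamma> \<Longrightarrow> \<gamma> 0 = x \<Longrightarrow> \<gamma> 1 = y \<Longrightarrow> B \<le> ereal (integral {0..1} (speed \<gamma>))"
  shows "B \<le> geodesic_dist M A g x y"
  unfolding geodesic_dist_def curve_length_eq piecewise_C1_curve_iff by (rule INF_greatest) (use assms in auto)

lemma geodesic_dist_nonneg: "0 \<le> geodesic_dist M A g x y"
  by (rule geodesic_dist_greatest) (use pw_C1_path_length_nonneg in force)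

text \<open>Concatenation of curves, each run at double speed.\<close>

lemma geodesic_dist_triangle_paths:
  assumes \<gamma>: "pw_C1_path 0 1 \<gamma>" "\<gamma> 0 = x" "\<gamma> 1 = y" and \<gamma>': "pw_C1_path 0 1 \<gamma>'" "\<gamma>' 0 = y" "\<gamma>' 1 = z"
  shows "geodesic_dist M A g x z \<le> ereal (integral {0..1} (speed \<gamma>)) + ereal (integral {0..1} (speed \<gamma>'))"
proof -
  let ?\<sigma> = "\<gamma> +++ \<gamma>'"
  have left: "pw_C1_path 0 (1 / 2) ?\<sigma>" and L: "integral {0..1 / 2} (speed ?\<sigma>) = integral {0..1} (speed \<gamma>)"
    using pw_C1_path_affine[OF \<gamma>(1), of 2 0 0 "1 / 2" ?\<sigma>] by (auto simp: joinpaths_def)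
  have right: "?\<sigma> s = \<gamma>' (2 * s + - 1)" if "s \<in> {1 / 2..1}" for s
  proof (cases "s = 1 / 2")
    case True
    show ?thesis
      unfolding True using \<gamma> \<gamma>' by (simp add: joinpaths_def)
  next
    case False
    then show ?thesis
      using that by (auto simp: joinpaths_def)
  qed
  have "pw_C1_path (1 / 2) 1 ?\<sigma>" and L': "integral {1 / 2..1} (speed ?\<sigma>) = integral {0..1} (speed \<gamma>')"
    using pw_C1_path_affine[OF \<gamma>'(1), of 2 "1 / 2" "-1" 1 ?\<sigma>] right by auto
  with left have pw: "pw_C1_path 0 1 ?\<sigma>"
    using pw_C1_path_join by blast
  have "integral {0..1} (speed ?\<sigma>) = integral {0..1} (speed \<gamma>) + integral {0..1} (speed \<gamma>')"
    using Henstock_Kurzweil_Integration.integral_combine[of 0 "1 / 2" 1 "speed ?\<sigma>"]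
      pw_C1_path_speed_integrable[OF pw] L L' by simp
  then show ?thesis
    using geodesic_dist_le_length[OF pw] \<gamma> \<gamma>' by (simp add: joinpaths_def)
qed

text \<open>The infimum is taken over one of the two curves at a time, moving the other length, and then the
  finite second distance, to the left-hand side.\<close>

lemma geodesic_dist_triangle:
  "geodesic_dist M A g x z \<le> geodesic_dist M A g x y + geodesic_dist M A g y z"
proof (cases "geodesic_dist M A g y z = \<infinity>")
  case False
  let ?d = "geodesic_dist M A g"
  have *: "?d x z \<le> ?d y z + ereal (integral {0..1} (speed \<gamma>))"
    if "pw_C1_path 0 1 \<gamma>" "\<gamma> 0 = x" "\<gamma> 1 = y" for \<gamma>
  proof -
    have "?d x z - ereal (integral {0..1} (speed \<gamma>)) \<le> ?d y z"
      by (rule geodesic_dist_greatest)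
        (use geodesic_dist_triangle_paths[OF that] in \<open>simp add: ereal_minus_le add.commute\<close>)
    then show ?thesis
      by (simp add: ereal_minus_le)
  qed
  have fin: "\<bar>?d y z\<bar> \<noteq> \<infinity>"
    using False geodesic_dist_nonneg[of y z] by auto
  have "?d x z - ?d y z \<le> ?d x y"
    by (rule geodesic_dist_greatest) (use * fin in \<open>simp add: ereal_minus_le add.commute\<close>)
  then show ?thesis
    using fin by (simp add: ereal_minus_le)
qed (use geodesic_dist_nonneg[of x y] in auto)

definition gram_norm :: "('m, 'n) chart \<Rightarrow> real ^ 'n \<Rightarrow> real ^ 'n \<Rightarrow> real" where
  "gram_norm c z v = sqrt (v \<bullet> (gram A g c z *v v))"

lemma gram_norm_nonneg: "c \<in> A \<Longrightarrow> z \<in> chart_img c \<Longrightarrow> 0 \<le> gram_norm c z v"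
  by (simp add: gram_norm_def gram_nonneg)

lemma gram_norm_pos: "c \<in> A \<Longrightarrow> z \<in> chart_img c \<Longrightarrow> v \<noteq> 0 \<Longrightarrow> 0 < gram_norm c z v"
  by (simp add: gram_norm_def gram_pos)

lemma gram_norm_square: "c \<in> A \<Longrightarrow> z \<in> chart_img c \<Longrightarrow> (gram_norm c z v)\<^sup>2 = v \<bullet> (gram A g c z *v v)"
  by (simp add: gram_norm_def gram_nonneg)

lemma gram_norm_scaleR: "c \<in> A \<Longrightarrow> z \<in> chart_img c \<Longrightarrow> gram_norm c z (a *\<^sub>R v) = \<bar>a\<bar> * gram_norm c z v"
  by (simp add: gram_norm_def matrix_vector_mult_scaleR real_sqrt_mult mult.assoc[symmetric] flip: power2_eq_square)

text \<open>The usual argument: the form is nonnegative at the component of \<open>v\<close> orthogonal to \<open>u\<close>.\<close>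

lemma gram_Cauchy_Schwarz:
  assumes c: "c \<in> A" "z \<in> chart_img c"
  shows "\<bar>u \<bullet> (gram A g c z *v v)\<bar> \<le> gram_norm c z u * gram_norm c z v"
proof (cases "u = 0")
  case True
  then show ?thesis using gram_norm_nonneg[OF c] by (simp add: gram_norm_def)
next
  case False
  let ?G = "gram A g c z"
  let ?a = "u \<bullet> (?G *v u)" and ?b = "u \<bullet> (?G *v v)" and ?d = "v \<bullet> (?G *v v)"
  let ?w = "v - (?b / ?a) *\<^sub>R u"
  have a: "?a > 0"
    using gram_pos[OF c False] .
  have "0 \<le> ?w \<bullet> (?G *v ?w)"
    by (rule gram_nonneg[OF c])
  also have "?w \<bullet> (?G *v ?w) = ?d - ?b\<^sup>2 / ?a"
    using a gram_commute[OF c, of v u]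
    by (simp add: matrix_vector_mult_diff_distrib matrix_vector_mult_scaleR inner_diff_left inner_diff_right
        power2_eq_square)
  finally have "?b\<^sup>2 \<le> ?a * ?d"
    using a by (simp add: field_simps)
  then have "\<bar>?b\<bar> \<le> sqrt (?a * ?d)"
    by (simp add: real_le_rsqrt)
  then show ?thesis
    by (simp add: gram_norm_def real_sqrt_mult)
qed

text \<open>The norm attains a positive minimum and a maximum on the unit sphere.\<close>

lemma gram_norm_equivalent:
  assumes c: "c \<in> A" "z \<in> chart_img c"
  obtains m B where "m > 0" "\<And>v. m * norm v \<le> gram_norm c z v" "\<And>v. gram_norm c z v \<le> B * norm v"
proof -
  have cont: "continuous_on (sphere 0 1) (gram_norm c z)"
    unfolding gram_norm_def by (intro continuous_intros)
  have nonempty: "sphere (0 :: real ^ 'n) 1 \<noteq> {}"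
    by (simp add: sphere_eq_empty)
  obtain u where u: "u \<in> sphere 0 1" "\<And>v. v \<in> sphere 0 1 \<Longrightarrow> gram_norm c z u \<le> gram_norm c z v"
    using continuous_attains_inf[OF compact_sphere nonempty cont] by blast
  obtain w where w: "w \<in> sphere 0 1" "\<And>v. v \<in> sphere 0 1 \<Longrightarrow> gram_norm c z v \<le> gram_norm c z w"
    using continuous_attains_sup[OF compact_sphere nonempty cont] by blast
  have bounds: "gram_norm c z u * norm v \<le> gram_norm c z v \<and> gram_norm c z v \<le> gram_norm c z w * norm v" for v
  proof (cases "v = 0")
    case True
    then show ?thesis by (simp add: gram_norm_def)
  next
    case False
    let ?e = "(1 / norm v) *\<^sub>R v"
    have "?e \<in> sphere 0 1"
      using False by simp
    then have "gram_norm c z u \<le> gram_norm c z ?e" "gram_norm c z ?e \<le> gram_norm c z w"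
      using u w by auto
    then show ?thesis
      using False by (simp add: gram_norm_scaleR[OF c] field_simps)
  qed
  have "gram_norm c z u > 0"
    by (rule gram_norm_pos[OF c]) (use u in auto)
  then show ?thesis
    using that bounds by blast
qed

lemma norm_matrix_vector_mult_le: "norm ((H :: real ^ 'k::finite ^ 'l::finite) *v v) \<le> norm H * norm v"
proof -
  have "norm (H *v v) \<le> L2_set (\<lambda>i. norm (H $ i) * norm v) UNIV"
    unfolding norm_vec_def[of "H *v v"] by (rule L2_set_mono) (auto simp: matrix_vector_mul_component Cauchy_Schwarz_ineq2)
  also have "\<dots> = norm H * norm v"
    by (simp add: L2_set_left_distrib norm_vec_def[of H])
  finally show ?thesis .
qed

text \<open>The Gram matrix is continuous, and \<open>v \<bullet> (G v)\<close> is bounded below by a multiple of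
  \<open>(norm v)\<^sup>2\<close>, so a small change of \<open>G\<close> changes the form by a small factor, uniformly in \<open>v\<close>.\<close>

lemma gram_norm_comparison:
  assumes c: "c \<in> A" "z \<in> chart_img c" and K: "K > 1"
  obtains r where "r > 0" "cball z r \<subseteq> chart_img c"
    "\<And>y v. y \<in> cball z r \<Longrightarrow> gram_norm c z v \<le> K * gram_norm c y v"
    "\<And>y v. y \<in> cball z r \<Longrightarrow> gram_norm c y v \<le> K * gram_norm c z v"
proof -
  obtain m where m: "m > 0" "\<And>v. m * norm v \<le> gram_norm c z v"
    using gram_norm_equivalent[OF c] by metis
  define x where "x = 1 / K\<^sup>2"
  \<comment> \<open>A change of the form by at most \<open>(1 - x)\<close> times its value stays within the factor \<open>K\<^sup>2\<close> in both directions, as \<open>1 - x \<le> K\<^sup>2 - 1\<close>.\<close>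
  define e where "e = m\<^sup>2 * (1 - x)"
  have K2: "K\<^sup>2 > 1"
    using K by (simp add: one_less_power)
  have K2': "x < 1"
    unfolding x_def using K2 divide_less_eq_1_pos[of "K\<^sup>2" 1] by linarith
  then have "e > 0"
    using m by (simp add: e_def)
  obtain r0 where r0: "r0 > 0" "cball z r0 \<subseteq> chart_img c"
    using open_chart_img[OF c(1)] c(2) open_contains_cball by blast
  obtain d where d: "d > 0" "\<And>y. y \<in> chart_img c \<Longrightarrow> dist y z < d \<Longrightarrow> dist (gram A g c y) (gram A g c z) < e"
    using continuous_on_gram[OF c(1)] c(2) \<open>e > 0\<close> unfolding continuous_on_iff by metis
  let ?r = "min r0 (d / 2)"
  have close: "\<bar>v \<bullet> (gram A g c y *v v) - v \<bullet> (gram A g c z *v v)\<bar> \<le> (1 - x) * (v \<bullet> (gram A g c z *v v))"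
    if y: "y \<in> cball z ?r" for y v
  proof -
    let ?H = "gram A g c y - gram A g c z"
    have "norm ?H \<le> e"
      using d(1) d(2)[of y] y r0 by (auto simp: dist_commute dist_norm subset_iff)
    have "\<bar>v \<bullet> (gram A g c y *v v) - v \<bullet> (gram A g c z *v v)\<bar> = \<bar>v \<bullet> (?H *v v)\<bar>"
      by (simp add: matrix_vector_mult_diff_rdistrib inner_diff_right)
    also have "\<dots> \<le> norm v * (norm ?H * norm v)"
      by (meson Cauchy_Schwarz_ineq2 mult_left_mono norm_ge_zero norm_matrix_vector_mult_le order_trans)
    also have "\<dots> \<le> norm v * (e * norm v)"
      using \<open>norm ?H \<le> e\<close> by (intro mult_left_mono mult_right_mono) auto
    also have "\<dots> = (1 - x) * (m * norm v)\<^sup>2"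
      by (simp add: e_def power2_eq_square)
    also have "\<dots> \<le> (1 - x) * (gram_norm c z v)\<^sup>2"
      using m K2' by (intro mult_left_mono power_mono) auto
    finally show ?thesis
      by (simp add: gram_norm_square[OF c])
  qed
  have lower: "gram_norm c z v \<le> K * gram_norm c y v" and upper: "gram_norm c y v \<le> K * gram_norm c z v"
    if y: "y \<in> cball z ?r" for y v
  proof -
    let ?q = "v \<bullet> (gram A g c z *v v)" and ?q' = "v \<bullet> (gram A g c y *v v)"
    have q: "?q \<ge> 0"
      by (rule gram_nonneg[OF c])
    have "x * ?q \<le> ?q'"
      using close[OF y, of v] by (simp add: algebra_simps abs_le_iff)
    then have "K\<^sup>2 * (x * ?q) \<le> K\<^sup>2 * ?q'"
      by (rule mult_left_mono) simp
    then have "?q \<le> K\<^sup>2 * ?q'"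
      using K by (simp add: x_def)
    then have "sqrt ?q \<le> sqrt (K\<^sup>2 * ?q')"
      by (rule real_sqrt_le_mono)
    then show "gram_norm c z v \<le> K * gram_norm c y v"
      using K by (simp add: gram_norm_def real_sqrt_mult)
    have "(1 - x) * 1 \<le> (1 - x) * K\<^sup>2"
      using K2 K2' by (intro mult_left_mono) auto
    also have "(1 - x) * K\<^sup>2 = K\<^sup>2 - 1"
      using K by (simp add: left_diff_distrib x_def)
    finally have "2 - x \<le> K\<^sup>2"
      by simp
    then have "(2 - x) * ?q \<le> K\<^sup>2 * ?q"
      using q by (rule mult_right_mono)
    moreover have "?q' \<le> (2 - x) * ?q"
      using close[OF y, of v] by (simp add: algebra_simps abs_le_iff)
    ultimately have "sqrt ?q' \<le> sqrt (K\<^sup>2 * ?q)"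
      by (intro real_sqrt_le_mono) linarith
    then show "gram_norm c y v \<le> K * gram_norm c z v"
      using K by (simp add: gram_norm_def real_sqrt_mult)
  qed
  show ?thesis
    by (rule that[of ?r]) (use r0 d lower upper in auto)
qed

text \<open>The straight segment in a chart is an admissible curve with velocity \<open>q - p\<close>.\<close>

lemma geodesic_dist_segment_le:
  assumes c: "c \<in> A" and seg: "closed_segment p q \<subseteq> chart_img c"
    and B: "\<And>y. y \<in> closed_segment p q \<Longrightarrow> gram_norm c y (q - p) \<le> B"
  shows "geodesic_dist M A g (chart_inv c p) (chart_inv c q) \<le> ereal B"
proof -
  define l where "l s = p + s *\<^sub>R (q - p)" for s :: real
  define \<gamma> where "\<gamma> s = chart_inv c (l s)" for s
  have l_mem: "l s \<in> closed_segment p q" if "s \<in> {0..1}" for s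
    unfolding closed_segment_def using that by (intro CollectI exI[of _ s]) (simp add: l_def algebra_simps)
  then have l_img: "l s \<in> chart_img c" if "s \<in> {0..1}" for s
    using that seg by blast
  have l_der: "(l has_vector_derivative (q - p)) (at s within T)" for s T
    unfolding l_def by (auto intro!: derivative_eq_intros)
  have l_cont: "continuous_on T l" for T
    unfolding l_def by (intro continuous_intros)
  have "C1_curve_on A 0 1 \<gamma>"
    unfolding C1_curve_on_def
  proof
    fix c' assume c': "c' \<in> A"
    let ?S = "{s \<in> {0..1}. \<gamma> s \<in> chart_dom c'}"
    let ?O = "chart_map c ` (chart_dom c \<inter> chart_dom c')"
    let ?D = "\<lambda>s. frechet_derivative (transition c c') (at (l s)) (q - p)"
    have l_O: "l s \<in> ?O" if "s \<in> ?S" for s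
      using that l_img[of s] c chart_map_chart_inv[OF c, of "l s"] chart_inv_in_dom[OF c, of "l s"]
      unfolding \<gamma>_def by (metis (no_types, lifting) IntI imageI mem_Collect_eq)
    have eq: "chart_map c' \<circ> \<gamma> = transition c c' \<circ> l"
      by (auto simp: \<gamma>_def transition_def)
    have "((chart_map c' \<circ> \<gamma>) has_vector_derivative ?D s) (at s within {0..1})" if "s \<in> ?S" for s
    proof -
      have "(transition c c' has_derivative frechet_derivative (transition c c') (at (l s))) (at (l s) within l ` {0..1})"
        by (rule has_derivative_at_withinI[OF transition_has_derivative[OF c c' l_O[OF that]]])
      from vector_derivative_diff_chain_within[OF l_der this] show ?thesis
        unfolding eq .
    qed
    moreover have "continuous_on ?S ?D"
      by (rule continuous_on_compose2[OF continuous_on_transition_derivative[OF c c'] l_cont]) (use l_O in auto)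
    ultimately show "\<exists>D. (\<forall>s\<in>?S. ((chart_map c' \<circ> \<gamma>) has_vector_derivative D s) (at s within {0..1}))
        \<and> continuous_on ?S D"
      by (intro exI[of _ ?D] conjI ballI)
  qed
  moreover have "continuous_on {0..1} \<gamma>"
    unfolding \<gamma>_def by (rule continuous_on_compose2[OF continuous_on_chart_inv[OF c] l_cont]) (use l_img in auto)
  moreover have \<gamma>_dom: "\<gamma> s \<in> chart_dom c" if "s \<in> {0..1}" for s
    using l_img[OF that] c by (simp add: \<gamma>_def)
  ultimately have pw: "pw_C1_path 0 1 \<gamma>"
    unfolding pw_C1_path_def using chart_dom_in_M[OF c] by (intro conjI exI[of _ 1] exI[of _ real]) auto
  \<comment> \<open>The speed is replaced by its bound \<open>B\<close> at the finitely many parameters where it may be meaningless.\<close>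
  obtain L where L: "finite L" "\<And>s. s \<in> {0..1} - L \<Longrightarrow> regular_at \<gamma> s"
    using pw_C1_path_regular[OF pw] by metis
  have "finite (L \<union> {0, 1})"
    using L(1) by simp
  from has_integral_spike_finite[OF this _ integrable_integral[OF pw_C1_path_speed_integrable[OF pw]],
      of "\<lambda>s. if s \<in> L \<union> {0, 1} then B else speed \<gamma> s"]
  have int: "((\<lambda>s. if s \<in> L \<union> {0, 1} then B else speed \<gamma> s) has_integral integral {0..1} (speed \<gamma>)) {0..1}"
    by simp
  have speed_le: "speed \<gamma> s \<le> B" if s: "s \<in> {0..1} - (L \<union> {0, 1})" for s
  proof -
    have reg: "regular_at \<gamma> s" and s01: "s \<in> {0..1}" "s \<in> {0<..<1}"
      using s L by auto
    have cs: "c \<in> charts_at A (\<gamma> s)"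
      using \<gamma>_dom[OF s01(1)] c by (simp add: charts_at_iff)
    have "((chart_map c \<circ> \<gamma>) has_vector_derivative (q - p)) (at s)"
      by (rule has_vector_derivative_transform_within_open[OF l_der open_greaterThanLessThan s01(2)])
        (use l_img c in \<open>auto simp: \<gamma>_def\<close>)
    moreover have "((chart_map c \<circ> \<gamma>) has_vector_derivative velocity A \<gamma> s c) (at s)"
      using reg cs by (simp add: regular_at_def)
    ultimately have "velocity A \<gamma> s c = q - p"
      by (rule vector_derivative_unique_at[rotated])
    moreover have "chart_map c (\<gamma> s) = l s"
      using l_img[OF s01(1)] c by (simp add: \<gamma>_def)
    ultimately show ?thesis
      using regular_speed_eq[OF reg cs] B[OF l_mem[OF s01(1)]] by (simp add: gram_norm_def)
  qed
  have "integral {0..1} (speed \<gamma>) \<le> B"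
    using has_integral_le[OF int, of "\<lambda>_. B" B] speed_le has_integral_const_real[of B 0 1] by auto
  then show ?thesis
    using geodesic_dist_le_length[OF pw] by (simp add: \<gamma>_def l_def) (metis ereal_less_eq(3) order_trans)
qed

lemma geodesic_dist_le_gram_norm:
  assumes c: "c \<in> A" and r: "cball z r \<subseteq> chart_img c"
    and K: "\<And>y v. y \<in> cball z r \<Longrightarrow> gram_norm c y v \<le> K * gram_norm c z v"
    and pq: "p \<in> cball z r" "q \<in> cball z r"
  shows "geodesic_dist M A g (chart_inv c p) (chart_inv c q) \<le> ereal (K * gram_norm c z (q - p))"
proof -
  have "closed_segment p q \<subseteq> cball z r"
    using pq by (simp add: closed_segment_subset)
  then show ?thesis
    using r K by (intro geodesic_dist_segment_le[OF c]) auto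
qed

text \<open>As long as the curve stays where the metric is close to its value at \<open>z\<close>, it is nearly as long as
  its displacement. With \<open>w\<close> the displacement and \<open>\<sigma>\<close> the curve in coordinates, the
  derivative of \<open>w \<bullet> (G \<sigma>)\<close> is at most \<open>K |w|\<close> times the speed, by the Cauchy-Schwarz inequality,
  while the function itself increases by \<open>|w|\<^sup>2\<close>.\<close>

lemma length_ge_displacement:
  assumes c: "c \<in> A" and r: "cball z r \<subseteq> chart_img c" "r > 0"
    and K: "K > 0" "\<And>y v. y \<in> cball z r \<Longrightarrow> gram_norm c z v \<le> K * gram_norm c y v"
    and \<gamma>: "pw_C1_path 0 1 \<gamma>" "\<gamma> 0 = chart_inv c z"
    and b: "0 \<le> b" "b \<le> 1" "\<And>s. s \<in> {0..b} \<Longrightarrow> \<gamma> s \<in> chart_inv c ` cball z r"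
  shows "gram_norm c z (chart_map c (\<gamma> b) - z) \<le> K * integral {0..1} (speed \<gamma>)"
proof -
  let ?\<sigma> = "chart_map c \<circ> \<gamma>" and ?G = "gram A g c z"
  let ?w = "?\<sigma> b - z"
  have z: "z \<in> chart_img c"
    using r by (auto simp: subset_iff)
  have dom: "\<gamma> s \<in> chart_dom c" and \<sigma>_mem: "?\<sigma> s \<in> cball z r" if "s \<in> {0..b}" for s
    using b(3)[OF that] r c by (auto simp: subset_iff)
  obtain L where L: "finite L" "\<And>s. s \<in> {0..1} - L \<Longrightarrow> regular_at \<gamma> s"
    using pw_C1_path_regular[OF \<gamma>(1)] by metis
  let ?\<phi> = "\<lambda>s. ?w \<bullet> (?G *v ?\<sigma> s)" and ?\<phi>' = "\<lambda>s. ?w \<bullet> (?G *v velocity A \<gamma> s c)"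
  have "(?\<phi>' has_integral (?\<phi> b - ?\<phi> 0)) {0..b}"
  proof (rule fundamental_theorem_of_calculus_interior_strong[OF L(1) b(1)])
    fix s assume s: "s \<in> {0<..<b} - L"
    then have "(?\<sigma> has_vector_derivative velocity A \<gamma> s c) (at s)"
      using L(2)[of s] dom[of s] b(2) c by (auto simp: regular_at_def charts_at_iff)
    moreover have "bounded_linear (\<lambda>u. ?w \<bullet> (?G *v u))"
      by (intro bounded_linear_inner_right_comp matrix_vector_mul_bounded_linear)
    ultimately show "(?\<phi> has_vector_derivative ?\<phi>' s) (at s)"
      by (rule bounded_linear.has_vector_derivative[rotated])
  next
    have "continuous_on {0..b} \<gamma>"
      using \<gamma>(1) b(2) by (auto simp: pw_C1_path_def intro: continuous_on_subset)
    moreover have "continuous_on (\<gamma> ` {0..b}) (chart_map c)"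
      by (rule continuous_on_subset[OF continuous_on_chart_map[OF c]]) (use dom in auto)
    ultimately have "continuous_on {0..b} ?\<sigma>"
      by (rule continuous_on_compose)
    then show "continuous_on {0..b} ?\<phi>"
      by (intro continuous_on_inner continuous_on_matrix_vector_mult continuous_on_const)
  qed
  moreover have "?\<phi> b - ?\<phi> 0 = (gram_norm c z ?w)\<^sup>2"
    using \<gamma>(2) c z by (simp add: gram_norm_square inner_diff_right matrix_vector_mult_diff_distrib)
  ultimately have int\<phi>: "(?\<phi>' has_integral (gram_norm c z ?w)\<^sup>2) {0..b}"
    by simp
  have "{0..b} \<subseteq> {0..1}"
    using b by auto
  from integrable_on_subinterval[OF pw_C1_path_speed_integrable[OF \<gamma>(1)] this]
  have "(speed \<gamma> has_integral integral {0..b} (speed \<gamma>)) {0..b}"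
    by (rule integrable_integral)
  note has_integral_mult_right[OF this, of "gram_norm c z ?w * K"]
  from has_integral_spike_finite[OF L(1) _ this,
      of "\<lambda>s. if s \<in> L then ?\<phi>' s else gram_norm c z ?w * K * speed \<gamma> s"]
  have "((\<lambda>s. if s \<in> L then ?\<phi>' s else gram_norm c z ?w * K * speed \<gamma> s) has_integral
      gram_norm c z ?w * K * integral {0..b} (speed \<gamma>)) {0..b}"
    by simp
  moreover have "?\<phi>' s \<le> gram_norm c z ?w * K * speed \<gamma> s" if s: "s \<in> {0..b} - L" for s
  proof -
    have reg: "regular_at \<gamma> s"
      using L(2)[of s] s b by auto
    have cs: "c \<in> charts_at A (\<gamma> s)"
      using dom s c by (auto simp: charts_at_iff)
    let ?v = "velocity A \<gamma> s c"
    have "?\<phi>' s \<le> gram_norm c z ?w * gram_norm c z ?v"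
      using gram_Cauchy_Schwarz[OF c z, of ?w ?v] by linarith
    also have "\<dots> \<le> gram_norm c z ?w * (K * gram_norm c (?\<sigma> s) ?v)"
      using K(2)[OF \<sigma>_mem[of s], of ?v] s gram_norm_nonneg[OF c z] by (intro mult_left_mono) auto
    also have "gram_norm c (?\<sigma> s) ?v = speed \<gamma> s"
      using regular_speed_eq[OF reg cs] by (simp add: gram_norm_def)
    finally show ?thesis
      by (simp add: mult.assoc)
  qed
  ultimately have "(gram_norm c z ?w)\<^sup>2 \<le> gram_norm c z ?w * K * integral {0..b} (speed \<gamma>)"
    by (intro has_integral_le[OF int\<phi>]) auto
  moreover have "integral {0..b} (speed \<gamma>) \<le> integral {0..1} (speed \<gamma>)"
    using Henstock_Kurzweil_Integration.integral_combine[OF b(1,2) pw_C1_path_speed_integrable[OF \<gamma>(1)]]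
      pw_C1_path_length_nonneg[OF \<gamma>(1), of b 1] b by auto
  then have "gram_norm c z ?w * K * integral {0..b} (speed \<gamma>) \<le> gram_norm c z ?w * K * integral {0..1} (speed \<gamma>)"
    using K(1) gram_norm_nonneg[OF c z, of ?w] by (intro mult_left_mono) auto
  ultimately have "gram_norm c z ?w * gram_norm c z ?w \<le> gram_norm c z ?w * (K * integral {0..1} (speed \<gamma>))"
    by (simp add: power2_eq_square mult.assoc)
  moreover have "0 \<le> K * integral {0..1} (speed \<gamma>)"
    using K(1) pw_C1_path_length_nonneg[OF \<gamma>(1), of 0 1] by simp
  ultimately show ?thesis
    using gram_norm_nonneg[OF c z, of ?w] mult_le_cancel_left_pos[of "gram_norm c z ?w"]
    by (cases "gram_norm c z ?w = 0") (auto simp: less_le)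
qed

text \<open>The curve is followed up to the first time at which it is outside the open ball. If there is no such
  time, this is \<open>b = 1\<close>; otherwise the curve is on the sphere at time \<open>b\<close>.\<close>

lemma exit_time:
  fixes \<gamma> :: "real \<Rightarrow> 'm"
  assumes c: "c \<in> A" and r: "cball z r \<subseteq> chart_img c" "r > 0"
    and \<gamma>: "continuous_on {0..1} \<gamma>" "\<gamma> ` {0..1} \<subseteq> M" "\<gamma> 0 = chart_inv c z"
  obtains b where "0 \<le> b" "b \<le> 1" "\<And>s. s \<in> {0..b} \<Longrightarrow> \<gamma> s \<in> chart_inv c ` cball z r"
    "b = 1 \<or> norm (chart_map c (\<gamma> b) - z) = r"
proof -
  let ?B = "chart_inv c ` ball z r" and ?C = "chart_inv c ` cball z r"
  let ?S = "{0..1} \<inter> \<gamma> -` (M - ?B)"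
  have "closed ?C"
    using r c by (intro compact_imp_closed compact_continuous_image continuous_on_subset[OF continuous_on_chart_inv]) auto
  have "openin (top_of_set M) ?B"
  proof -
    have "openin (top_of_set (chart_dom c)) (chart_inv c ` ball z r)"
    proof (rule homeomorphism_imp_open_map[OF homeomorphism_symD[OF homeomorphism_chart[OF c]]])
      show "openin (top_of_set (chart_img c)) (ball z r)"
        using r open_chart_img[OF c] by (simp add: openin_open_eq) (meson ball_subset_cball order_trans)
    qed
    then show ?thesis
      using openin_chart_dom[OF c] openin_trans by blast
  qed
  then have "closedin (top_of_set M) (M - ?B)"
    by (simp add: closedin_diff)
  then have "closedin (top_of_set {0..1}) ?S"
    using \<gamma>(1,2) by (intro continuous_closedin_preimage_gen) auto
  then have compS: "compact ?S"
    by (rule closedin_compact[OF compact_Icc])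
  show ?thesis
  proof (cases "?S = {}")
    case True
    have "\<gamma> s \<in> ?B" if s: "s \<in> {0..1}" for s
    proof (rule ccontr)
      assume "\<gamma> s \<notin> ?B"
      then have "s \<in> ?S"
        using s \<gamma>(2) by auto
      with True show False
        by simp
    qed
    then show ?thesis
      using that[of 1] by force
  next
    case False
    then obtain b where b: "b \<in> ?S" "\<And>s. s \<in> ?S \<Longrightarrow> b \<le> s"
      using compact_attains_inf[OF compS] by blast
    have inB: "\<gamma> s \<in> ?B" if "s \<in> {0..<b}" for s
      using b(2)[of s] that b(1) \<gamma>(2) by force
    have "\<gamma> 0 \<in> ?B"
      using \<gamma>(3) r by auto
    then have b0: "0 < b"
      using b(1) by (cases "b = 0") auto
    have "\<gamma> b \<in> ?C"
    proof -
      have "continuous_on (closure {0..<b}) \<gamma>"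
        using \<gamma>(1) b b0 by (auto intro: continuous_on_subset)
      then have "\<gamma> ` closure {0..<b} \<subseteq> ?C"
        using \<open>closed ?C\<close> inB by (intro image_closure_subset) force+
      then show ?thesis
        using b0 by auto
    qed
    then have "norm (chart_map c (\<gamma> b) - z) = r"
      using b(1) r c by (force simp: dist_norm norm_minus_commute subset_iff)
    moreover have "\<gamma> s \<in> ?C" if "s \<in> {0..b}" for s
      using inB[of s] \<open>\<gamma> b \<in> ?C\<close> that by (cases "s = b") force+
    ultimately show ?thesis
      using that[of b] b b0 by auto
  qed
qed

text \<open>A curve to a point near \<open>z\<close> either stays in the ball, and then its displacement is \<open>y - z\<close>, or it
  reaches the sphere of radius \<open>r\<close>, where the displacement is at least as long as \<open>y - z\<close> in the norm at \<open>z\<close>.\<close>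

lemma gram_norm_le_geodesic_dist:
  assumes c: "c \<in> A" "z \<in> chart_img c" and K: "K > 1"
  obtains d where "d > 0"
    "\<And>y. y \<in> chart_img c \<Longrightarrow> dist y z < d \<Longrightarrow>
      ereal (gram_norm c z (y - z) / K) \<le> geodesic_dist M A g (chart_inv c z) (chart_inv c y)"
proof -
  obtain r where r: "r > 0" "cball z r \<subseteq> chart_img c"
    and comp: "\<And>y v. y \<in> cball z r \<Longrightarrow> gram_norm c z v \<le> K * gram_norm c y v"
    using gram_norm_comparison[OF c K] by metis
  obtain m B where m: "m > 0" "\<And>v. m * norm v \<le> gram_norm c z v" "\<And>v. gram_norm c z v \<le> B * norm v"
    using gram_norm_equivalent[OF c] by metis
  \<comment> \<open>Within distance \<open>d\<close> the norm at \<open>z\<close> is at most \<open>m * r\<close>, a lower bound for it on the sphere of radius \<open>r\<close>.\<close>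
  define d where "d = m * r / (\<bar>B\<bar> + 1)"
  have d: "d > 0"
    using m r by (simp add: d_def add_nonneg_pos)
  have "ereal (gram_norm c z (y - z) / K) \<le> geodesic_dist M A g (chart_inv c z) (chart_inv c y)"
    if y: "y \<in> chart_img c" "dist y z < d" for y
  proof (rule geodesic_dist_greatest)
    fix \<gamma> assume \<gamma>: "pw_C1_path 0 1 \<gamma>" "\<gamma> 0 = chart_inv c z" "\<gamma> 1 = chart_inv c y"
    have "continuous_on {0..1} \<gamma>" "\<gamma> ` {0..1} \<subseteq> M"
      using \<gamma>(1) by (auto simp: pw_C1_path_def)
    then obtain b where b: "0 \<le> b" "b \<le> 1" "\<And>s. s \<in> {0..b} \<Longrightarrow> \<gamma> s \<in> chart_inv c ` cball z r"
      "b = 1 \<or> norm (chart_map c (\<gamma> b) - z) = r"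
      using exit_time[of c z r \<gamma>, OF c(1) r(2,1)] \<gamma>(2) by blast
    have "gram_norm c z (y - z) \<le> gram_norm c z (chart_map c (\<gamma> b) - z)"
      using b(4)
    proof
      assume "b = 1"
      then show ?thesis
        using \<gamma>(3) y(1) c(1) by simp
    next
      assume exit: "norm (chart_map c (\<gamma> b) - z) = r"
      have "gram_norm c z (y - z) \<le> (\<bar>B\<bar> + 1) * norm (y - z)"
        by (rule order_trans[OF m(3)]) (auto intro: mult_right_mono)
      also have "\<dots> \<le> m * r"
        using y(2) by (simp add: d_def dist_norm pos_less_divide_eq add_nonneg_pos mult.commute)
      also have "\<dots> \<le> gram_norm c z (chart_map c (\<gamma> b) - z)"
        using m(2)[of "chart_map c (\<gamma> b) - z"] exit by simp
      finally show ?thesis .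
    qed
    also have "\<dots> \<le> K * integral {0..1} (speed \<gamma>)"
      by (rule length_ge_displacement[OF c(1) r(2,1) _ comp \<gamma>(1,2) b(1-3)]) (use K in auto)
    finally have "gram_norm c z (y - z) \<le> K * integral {0..1} (speed \<gamma>)" .
    then show "ereal (gram_norm c z (y - z) / K) \<le> ereal (integral {0..1} (speed \<gamma>))"
      using K by (simp add: field_simps)
  qed
  with d show ?thesis
    by (rule that)
qed

end

section \<open>Existence and uniqueness of the Riemannian volume\<close>

locale compact_riemannian_manifold = riemannian_manifold M A g k
  for M :: "'m::t2_space set" and A :: "('m, 'n::finite) chart set" and g k +
  assumes compact: "compact M"
begin

abbreviation borel_M :: "'m measure" where
  "borel_M \<equiv> restrict_space borel M"

definition vol_density :: "('m, 'n) chart \<Rightarrow> real ^ 'n \<Rightarrow> real" where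
  "vol_density c z = sqrt (det (gram A g c z))"

definition chart_volume :: "('m, 'n) chart \<Rightarrow> 'm set \<Rightarrow> ennreal" where
  "chart_volume c B = (\<integral>\<^sup>+z\<in>chart_map c ` B. ennreal (vol_density c z) \<partial>lborel)"

lemma is_riemannian_volume_iff:
  "is_riemannian_volume M A g \<mu> \<longleftrightarrow> space \<mu> = M \<and> sets \<mu> = sets borel_M \<and>
     (\<forall>c\<in>A. \<forall>B\<in>sets \<mu>. B \<subseteq> chart_dom c \<longrightarrow> emeasure \<mu> B = chart_volume c B)"
  by (simp add: is_riemannian_volume_def chart_volume_def vol_density_def)

lemma vol_density_pos: "c \<in> A \<Longrightarrow> z \<in> chart_img c \<Longrightarrow> vol_density c z > 0"
  by (simp add: vol_density_def det_gram_pos)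

lemma continuous_on_vol_density: "c \<in> A \<Longrightarrow> continuous_on (chart_img c) (vol_density c)"
  unfolding vol_density_def det_def
  by (intro continuous_intros continuous_on_component continuous_on_gram)

lemma M_borel [measurable]: "M \<in> sets borel"
  by (simp add: compact borel_closed compact_imp_closed)

lemma borel_M_subset: "B \<in> sets borel_M \<Longrightarrow> B \<subseteq> M"
  using sets.sets_into_space[of B borel_M] by simp

lemma borel_M_iff: "B \<in> sets borel_M \<longleftrightarrow> B \<subseteq> M \<and> B \<in> sets borel"
  by (subst sets_restrict_space_iff) auto

lemma openin_borel_M: "openin (top_of_set M) U \<Longrightarrow> U \<in> sets borel_M"
  by (auto simp: borel_M_iff openin_open)

lemma chart_dom_borel: "c \<in> A \<Longrightarrow> chart_dom c \<in> sets borel_M"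
  by (intro openin_borel_M openin_chart_dom)

lemma chart_inv_measurable: "c \<in> A \<Longrightarrow> chart_inv c \<in> borel_measurable (restrict_space borel (chart_img c))"
  by (intro borel_measurable_continuous_on_restrict continuous_on_chart_inv)

lemma chart_image_eq_vimage:
  assumes "c \<in> A" "B \<subseteq> chart_dom c"
  shows "chart_map c ` B = chart_inv c -` B \<inter> chart_img c"
  using assms by (auto simp: subset_iff)

lemma chart_image_borel [measurable]:
  assumes "c \<in> A" "B \<in> sets borel_M" "B \<subseteq> chart_dom c"
  shows "chart_map c ` B \<in> sets borel"
  using measurable_sets[OF chart_inv_measurable[OF assms(1)], of B] assms(2) open_chart_img[OF assms(1)]
  by (simp add: chart_image_eq_vimage[OF assms(1,3)] borel_M_iff space_restrict_space sets_restrict_space_iff)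

lemma set_borel_measurable_vol_density:
  assumes "c \<in> A" "S \<in> sets borel" "S \<subseteq> chart_img c"
  shows "set_borel_measurable borel S (vol_density c)"
  using assms continuous_on_subset[OF continuous_on_vol_density]
  by (intro borel_measurable_continuous_on_indicator[folded set_borel_measurable_def]) auto

text \<open>The change of variables formula for the transition map.\<close>

lemma chart_volume_transition:
  assumes c: "c \<in> A" "c' \<in> A" and B: "B \<in> sets borel_M" "B \<subseteq> chart_dom c" "B \<subseteq> chart_dom c'"
  shows "chart_volume c B = chart_volume c' B"
proof -
  let ?T = "transition c c'" and ?S = "chart_map c ` B"
  let ?T' = "\<lambda>z. frechet_derivative ?T (at z)"
  have TS: "?T ` ?S = chart_map c' ` B"
    using c B by (force simp: image_image subset_iff)
  have vol_density_eq: "\<bar>det (matrix (?T' z))\<bar> * vol_density c' (?T z) = vol_density c z" if "z \<in> ?S" for z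
    using that sqrt_det_gram_transition[OF c] B c by (auto simp: vol_density_def subset_iff)
  have "chart_volume c' B = (\<integral>\<^sup>+z\<in>?T ` ?S. ennreal (vol_density c' z) \<partial>lborel)"
    by (simp add: chart_volume_def TS)
  also have "\<dots> = (\<integral>\<^sup>+z\<in>?S. ennreal (\<bar>det (matrix (?T' z))\<bar> * vol_density c' (?T z)) \<partial>lborel)"
  proof (rule nn_integral_change_of_variables)
    show "?S \<in> sets borel" "?T ` ?S \<in> sets borel"
      unfolding TS using c B by (auto intro: chart_image_borel)
    show "(?T has_derivative ?T' z) (at z within ?S)" if "z \<in> ?S" for z
      by (rule has_derivative_at_withinI, rule transition_has_derivative[OF c]) (use that B in auto)
    show "inj_on ?T ?S"
    proof (rule inj_onI)
      fix z w assume z: "z \<in> ?S" "w \<in> ?S" and eq: "?T z = ?T w"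
      then obtain x y where x: "z = chart_map c x" "w = chart_map c y" "x \<in> B" "y \<in> B"
        by auto
      then have "x \<in> chart_dom c" "y \<in> chart_dom c" "x \<in> chart_dom c'" "y \<in> chart_dom c'"
        using B by auto
      with x eq c have "chart_inv c' (chart_map c' x) = chart_inv c' (chart_map c' y)"
        by (simp del: chart_inv_chart_map)
      with \<open>x \<in> chart_dom c'\<close> \<open>y \<in> chart_dom c'\<close> c x show "z = w"
        by simp
    qed
    show "0 \<le> vol_density c' z" if "z \<in> ?T ` ?S" for z
      using that B c unfolding TS by (intro less_imp_le vol_density_pos) auto
    show "set_borel_measurable borel (?T ` ?S) (vol_density c')"
      unfolding TS using c B by (intro set_borel_measurable_vol_density chart_image_borel) auto
    have "set_borel_measurable borel ?S (vol_density c)"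
      using c B by (intro set_borel_measurable_vol_density chart_image_borel) auto
    moreover have "(\<lambda>z. indicator ?S z *\<^sub>R (\<bar>det (matrix (?T' z))\<bar> * vol_density c' (?T z))) = (\<lambda>z. indicator ?S z *\<^sub>R vol_density c z)"
      using vol_density_eq by (auto simp: indicator_def)
    ultimately show "set_borel_measurable borel ?S (\<lambda>z. \<bar>det (matrix (?T' z))\<bar> * vol_density c' (?T z))"
      by (simp only: set_borel_measurable_def)
  qed
  also have "\<dots> = chart_volume c B"
    unfolding chart_volume_def using vol_density_eq by (intro nn_integral_cong) (auto simp: indicator_def)
  finally show ?thesis ..
qed

lemma chart_volume_suminf:
  assumes c: "c \<in> A" and B: "\<And>n. B n \<in> sets borel_M" "\<And>n. B n \<subseteq> chart_dom c" and disj: "disjoint_family B"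
  shows "chart_volume c (\<Union>n. B n) = (\<Sum>n. chart_volume c (B (n :: nat)))"
proof -
  let ?N = "density lborel (\<lambda>z. ennreal (indicator (chart_img c) z *\<^sub>R vol_density c z))"
  have meas: "(\<lambda>z. ennreal (indicator (chart_img c) z *\<^sub>R vol_density c z)) \<in> borel_measurable lborel"
    using set_borel_measurable_vol_density[OF c, of "chart_img c"] open_chart_img[OF c]
    by (simp add: set_borel_measurable_def)
  have vol: "chart_volume c D = emeasure ?N (chart_map c ` D)" if "D \<in> sets borel_M" "D \<subseteq> chart_dom c" for D
    using chart_image_borel[OF c that] unfolding chart_volume_def
    by (subst emeasure_density[OF meas])
      (auto intro!: nn_integral_cong simp: indicator_def imageI[OF subsetD[OF that(2)]])
  have "disjoint_family (\<lambda>n. chart_map c ` B n)"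
    unfolding disjoint_family_on_def
  proof (intro ballI impI)
    fix m n :: nat assume "m \<noteq> n"
    then have "B m \<inter> B n = {}"
      using disj by (simp add: disjoint_family_on_def)
    moreover have "inj_on (chart_map c) (chart_dom c)"
      using c by (intro inj_on_inverseI[of _ "chart_inv c"]) simp
    ultimately show "chart_map c ` B m \<inter> chart_map c ` B n = {}"
      using inj_on_image_Int[of "chart_map c" "chart_dom c" "B m" "B n"] B(2) by simp
  qed
  then have "(\<Sum>n. emeasure ?N (chart_map c ` B n)) = emeasure ?N (\<Union>n. chart_map c ` B n)"
    using chart_image_borel[OF c B] by (intro suminf_emeasure) auto
  then show ?thesis
    using B vol[of "\<Union>n. B n"] by (simp add: vol image_UN UN_least)
qed

lemma chart_volume_empty [simp]: "chart_volume c {} = 0"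
  by (simp add: chart_volume_def)

text \<open>Finitely many chart domains cover \<open>M\<close>; removing from each the preceding ones makes them disjoint.\<close>

lemma finite_chart_partition:
  obtains n :: nat and cs P where "\<And>i. i < n \<Longrightarrow> cs i \<in> A" "\<And>i. i < n \<Longrightarrow> P i \<in> sets borel_M"
    "\<And>i. i < n \<Longrightarrow> P i \<subseteq> chart_dom (cs i)" "disjoint_family_on P {..<n}" "(\<Union>i<n. P i) = M"
proof -
  have "\<exists>C. finite C \<and> C \<subseteq> A \<and> M \<subseteq> (\<Union>c\<in>C. chart_dom c)"
  proof -
    have "\<forall>c\<in>A. \<exists>T. open T \<and> chart_dom c = M \<inter> T"
      using openin_chart_dom by (auto simp: openin_open)
    then obtain T where T: "\<And>c. c \<in> A \<Longrightarrow> open (T c) \<and> chart_dom c = M \<inter> T c"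
      by metis
    have cover: "M \<subseteq> (\<Union>c\<in>A. T c)"
    proof
      fix x assume "x \<in> M"
      then obtain c where "c \<in> A" "x \<in> chart_dom c"
        by (rule ex_chart)
      then show "x \<in> (\<Union>c\<in>A. T c)"
        using T by blast
    qed
    obtain C where "C \<subseteq> A" "finite C" "M \<subseteq> (\<Union>c\<in>C. T c)"
      by (rule compactE_image[OF compact _ cover]) (use T in auto)
    moreover have "x \<in> chart_dom c" if "x \<in> M" "x \<in> T c" "c \<in> C" for x c
      using that T \<open>C \<subseteq> A\<close> by blast
    ultimately show ?thesis
      by (intro exI[of _ C]) blast
  qed
  then obtain xs where xs: "set xs \<subseteq> A" "M \<subseteq> (\<Union>c\<in>set xs. chart_dom c)"
    by (metis finite_list)
  define P where "P i = chart_dom (xs ! i) - (\<Union>j<i. chart_dom (xs ! j))" for i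
  show ?thesis
  proof (rule that[of "length xs" "(!) xs" P])
    show "P i \<in> sets borel_M" if "i < length xs" for i
    proof -
      have "xs ! j \<in> A" if "j \<le> i" for j
        using that \<open>i < length xs\<close> xs(1) by (meson le_less_trans nth_mem subsetD)
      then show ?thesis
        unfolding P_def by (intro sets.Diff sets.finite_UN chart_dom_borel) auto
    qed
    show "disjoint_family_on P {..<length xs}"
    proof -
      have "P i \<inter> P j = {}" if "i < j" for i j
        using that by (auto simp: P_def)
      then show ?thesis
        unfolding disjoint_family_on_def by (metis Int_commute nat_neq_iff)
    qed
    show "(\<Union>i<length xs. P i) = M"
    proof
      show "(\<Union>i<length xs. P i) \<subseteq> M"
      proof (rule UN_least)
        fix i assume "i \<in> {..<length xs}"
        then have "xs ! i \<in> A"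
          using xs(1) by (meson lessThan_iff nth_mem subsetD)
        from chart_dom_subset[OF this] show "P i \<subseteq> M"
          unfolding P_def by blast
      qed
      show "M \<subseteq> (\<Union>i<length xs. P i)"
      proof
        fix x assume "x \<in> M"
        then obtain c where "c \<in> set xs" "x \<in> chart_dom c"
          using xs(2) by blast
        then obtain i where "i < length xs \<and> x \<in> chart_dom (xs ! i)"
          by (metis in_set_conv_nth)
        then have "\<exists>i. i < length xs \<and> x \<in> P i"
        proof (induction i rule: less_induct)
          case (less i)
          then show ?case
            unfolding P_def by (cases "\<exists>j<i. x \<in> chart_dom (xs ! j)") auto
        qed
        then show "x \<in> (\<Union>i<length xs. P i)"
          by blast
      qed
    qed
    show "xs ! i \<in> A" if "i < length xs" for i
      using that xs(1) by (meson nth_mem subsetD)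
    show "P i \<subseteq> chart_dom (xs ! i)" for i
      by (simp add: P_def)
  qed
qed

text \<open>Additivity over the partition forces the value of the volume on every Borel set. Conversely, the
  sum of the chart volumes over the pieces is a measure, and it has the right value on subsets of
  any other chart domain because chart volumes agree on overlaps.\<close>

lemma ex1_riemannian_volume: "\<exists>!\<mu>. is_riemannian_volume M A g \<mu>"
proof -
  obtain n :: nat and cs P where cs: "\<And>i. i < n \<Longrightarrow> cs i \<in> A"
    and P: "\<And>i. i < n \<Longrightarrow> P i \<in> sets borel_M" "\<And>i. i < n \<Longrightarrow> P i \<subseteq> chart_dom (cs i)"
    and disj: "disjoint_family_on P {..<n}" and UP: "(\<Union>i<n. P i) = M"
    using finite_chart_partition by metis
  define vol where "vol B = (\<Sum>i<n. chart_volume (cs i) (B \<inter> P i))" for B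
  define \<mu> where "\<mu> = measure_of M (sets borel_M) vol"
  have sets_\<mu>: "sets \<mu> = sets borel_M" and space_\<mu>: "space \<mu> = M"
    using sets.sigma_sets_eq[of borel_M] sets.space_closed[of borel_M] by (auto simp: \<mu>_def)
  have emeasure_\<mu>: "emeasure \<mu> B = vol B" if "B \<in> sets borel_M" for B
    unfolding \<mu>_def
  proof (rule emeasure_measure_of_sigma)
    show "sigma_algebra M (sets borel_M)"
      using sets.sigma_algebra_axioms[of borel_M] by simp
    show "positive (sets borel_M) vol"
      by (simp add: positive_def vol_def)
    show "countably_additive (sets borel_M) vol"
    proof (rule countably_additiveI)
      fix F :: "nat \<Rightarrow> 'm set"
      assume F: "range F \<subseteq> sets borel_M" "disjoint_family F"
      have "(\<Sum>j. vol (F j)) = (\<Sum>i<n. \<Sum>j. chart_volume (cs i) (F j \<inter> P i))"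
        unfolding vol_def by (rule suminf_sum) (rule summableI)
      also have "\<dots> = (\<Sum>i<n. chart_volume (cs i) (\<Union>j. F j \<inter> P i))"
      proof (rule sum.cong)
        fix i assume i: "i \<in> {..<n}"
        have "disjoint_family (\<lambda>j. F j \<inter> P i)"
          using F(2) by (auto simp: disjoint_family_on_def)
        then show "(\<Sum>j. chart_volume (cs i) (F j \<inter> P i)) = chart_volume (cs i) (\<Union>j. F j \<inter> P i)"
          using F(1) P[of i] cs[of i] i
          by (intro chart_volume_suminf[symmetric]) auto
      qed simp
      also have "\<dots> = vol (\<Union>j. F j)"
        by (simp add: vol_def)
      finally show "(\<Sum>j. vol (F j)) = vol (\<Union>j. F j)" .
    qed
  qed fact
  have vol_unique: "emeasure \<nu> B = vol B" if \<nu>: "is_riemannian_volume M A g \<nu>" and B: "B \<in> sets borel_M" for \<nu> B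
  proof -
    have sets_\<nu>: "sets \<nu> = sets borel_M"
      using \<nu> by (simp add: is_riemannian_volume_iff)
    have "B = (\<Union>i<n. B \<inter> P i)"
      using UP borel_M_subset[OF B] by blast
    moreover have "(\<Sum>i<n. emeasure \<nu> (B \<inter> P i)) = emeasure \<nu> (\<Union>i<n. B \<inter> P i)"
      using disj B P by (intro sum_emeasure) (auto simp: sets_\<nu> disjoint_family_on_def)
    ultimately have "emeasure \<nu> B = (\<Sum>i<n. emeasure \<nu> (B \<inter> P i))"
      by simp
    also have "\<dots> = vol B"
      unfolding vol_def
    proof (rule sum.cong)
      fix i assume "i \<in> {..<n}"
      then show "emeasure \<nu> (B \<inter> P i) = chart_volume (cs i) (B \<inter> P i)"
        using \<nu> cs[of i] P[of i] B unfolding is_riemannian_volume_iff by (metis Int_lower2 lessThan_iff order_trans sets.Int)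
    qed simp
    finally show ?thesis .
  qed
  have "is_riemannian_volume M A g \<mu>"
    unfolding is_riemannian_volume_iff
  proof (intro conjI ballI impI)
    fix c B assume c: "c \<in> A" and B: "B \<in> sets \<mu>" "B \<subseteq> chart_dom c"
    have BP: "B \<inter> P i \<in> sets borel_M" if "i < n" for i
      using B P[OF that] by (simp add: sets_\<mu>)
    have "emeasure \<mu> B = (\<Sum>i<n. chart_volume (cs i) (B \<inter> P i))"
      using B emeasure_\<mu> by (simp add: sets_\<mu> vol_def)
    also have "\<dots> = (\<Sum>i<n. chart_volume c (B \<inter> P i))"
      using BP P B by (intro sum.cong chart_volume_transition c cs) auto
    \<comment> \<open>Finite additivity, as countable additivity for a family that is empty from \<open>n\<close> on.\<close>
    also have "\<dots> = (\<Sum>i. chart_volume c (if i < n then B \<inter> P i else {}))"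
      by (subst suminf_finite[of "{..<n}"]) auto
    also have "\<dots> = chart_volume c (\<Union>i. if i < n then B \<inter> P i else {})"
    proof (rule chart_volume_suminf[symmetric, OF c])
      have "P i \<inter> P j = {}" if "i < n" "j < n" "i \<noteq> j" for i j
        using disj that by (simp add: disjoint_family_on_def)
      then show "disjoint_family (\<lambda>i. if i < n then B \<inter> P i else {})"
        unfolding disjoint_family_on_def by (simp, blast)
    qed (use BP B in auto)
    also have "(\<Union>i. if i < n then B \<inter> P i else {}) = B"
      using UP borel_M_subset[of B] B by (auto simp: sets_\<mu> split: if_splits)
    finally show "emeasure \<mu> B = chart_volume c B" .
  qed (fact space_\<mu> sets_\<mu>)+
  moreover have "\<nu> = \<mu>" if "is_riemannian_volume M A g \<nu>" for \<nu>
    using that vol_unique[OF that] emeasure_\<mu>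
    by (intro measure_eqI) (auto simp: is_riemannian_volume_iff sets_\<mu>)
  ultimately show ?thesis
    by blast
qed

abbreviation vol_M :: "'m measure" where
  "vol_M \<equiv> riemannian_volume M A g"

lemma is_riemannian_volume_vol_M: "is_riemannian_volume M A g vol_M"
  unfolding riemannian_volume_def by (rule theI'[OF ex1_riemannian_volume])

lemma sets_vol_M [simp]: "sets vol_M = sets borel_M" and space_vol_M [simp]: "space vol_M = M"
  and emeasure_vol_M: "c \<in> A \<Longrightarrow> B \<in> sets borel_M \<Longrightarrow> B \<subseteq> chart_dom c \<Longrightarrow> emeasure vol_M B = chart_volume c B"
  using is_riemannian_volume_vol_M by (auto simp: is_riemannian_volume_iff)

text \<open>On a chart domain the volume is the image of a measure with density on the coordinate side.\<close>

lemma integral_vol_M_chart: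
  fixes h :: "'m \<Rightarrow> real"
  assumes c: "c \<in> A" and supp: "\<And>y. y \<in> M \<Longrightarrow> y \<notin> chart_dom c \<Longrightarrow> h y = 0"
    and h: "continuous_on (chart_img c) (\<lambda>z. h (chart_inv c z))"
  shows "(\<integral>y. h y \<partial>vol_M) = (\<integral>z. indicator (chart_img c) z *\<^sub>R (vol_density c z * h (chart_inv c z)) \<partial>lborel)"
proof -
  let ?U = "chart_dom c" and ?V = "chart_img c"
  let ?L = "restrict_space lborel ?V"
  have V: "?V \<in> sets borel"
    using open_chart_img[OF c] by simp
  have U: "?U \<in> sets borel_M"
    by (rule chart_dom_borel[OF c])
  have sets_U: "B \<in> sets (restrict_space vol_M ?U) \<longleftrightarrow> B \<in> sets borel_M \<and> B \<subseteq> ?U" for B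
    using U by (subst sets_restrict_space_iff) (auto simp: Int_absorb2 borel_M_subset)
  have sets_L: "sets ?L = sets (restrict_space borel ?V)"
    by (rule sets_restrict_space_cong) simp
  have vol_density_meas: "vol_density c \<in> borel_measurable ?L"
    using borel_measurable_continuous_on_restrict[OF continuous_on_vol_density[OF c]] measurable_cong_sets[OF sets_L refl] by blast
  have inv_meas: "chart_inv c \<in> ?L \<rightarrow>\<^sub>M restrict_space vol_M ?U"
  proof (rule measurableI)
    show "chart_inv c z \<in> space (restrict_space vol_M ?U)" if "z \<in> space ?L" for z
      using that c chart_dom_in_M[OF c] by (simp add: space_restrict_space)
    show "chart_inv c -` B \<inter> space ?L \<in> sets ?L" if "B \<in> sets (restrict_space vol_M ?U)" for B
      using that measurable_sets[OF chart_inv_measurable[OF c], of B]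
      by (simp add: sets_U sets_L borel_M_iff space_restrict_space)
  qed
  have vol_U: "restrict_space vol_M ?U = distr (density ?L (\<lambda>z. ennreal (vol_density c z))) (restrict_space vol_M ?U) (chart_inv c)"
  proof (rule measure_eqI)
    fix B assume "B \<in> sets (restrict_space vol_M ?U)"
    then have B: "B \<in> sets borel_M" "B \<subseteq> ?U" "B \<in> sets (restrict_space vol_M ?U)"
      by (simp_all add: sets_U)
    have pre: "chart_inv c -` B \<inter> space ?L \<in> sets ?L"
      by (rule measurable_sets[OF inv_meas B(3)])
    have "emeasure (distr (density ?L (\<lambda>z. ennreal (vol_density c z))) (restrict_space vol_M ?U) (chart_inv c)) B
        = emeasure (density ?L (\<lambda>z. ennreal (vol_density c z))) (chart_inv c -` B \<inter> space ?L)"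
      using inv_meas B(3) by (subst emeasure_distr) auto
    also have "\<dots> = (\<integral>\<^sup>+z\<in>chart_inv c -` B \<inter> space ?L. ennreal (vol_density c z) \<partial>?L)"
      using vol_density_meas pre by (intro emeasure_density) auto
    also have "\<dots> = (\<integral>\<^sup>+z\<in>?V. (ennreal (vol_density c z) * indicator (chart_inv c -` B \<inter> space ?L) z) \<partial>lborel)"
      using V by (subst nn_integral_restrict_space) auto
    also have "\<dots> = chart_volume c B"
      unfolding chart_volume_def chart_image_eq_vimage[OF c B(2)]
      by (intro nn_integral_cong) (auto simp: indicator_def space_restrict_space)
    also have "\<dots> = emeasure (restrict_space vol_M ?U) B"
      using U B emeasure_vol_M[OF c B(1,2)] by (subst emeasure_restrict_space) (auto simp: Int_absorb2 chart_dom_subset[OF c])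
    finally show "emeasure (restrict_space vol_M ?U) B =
        emeasure (distr (density ?L (\<lambda>z. ennreal (vol_density c z))) (restrict_space vol_M ?U) (chart_inv c)) B" ..
  qed simp
  have h_meas: "h \<in> borel_measurable (restrict_space vol_M ?U)"
  proof -
    have map_meas: "chart_map c \<in> borel_measurable (restrict_space borel ?U)"
      by (intro borel_measurable_continuous_on_restrict continuous_on_chart_map[OF c])
    have "continuous_on ?U (\<lambda>y. h (chart_inv c (chart_map c y)))"
      by (rule continuous_on_compose2[OF h continuous_on_chart_map[OF c]]) auto
    then have "continuous_on ?U h"
      by (rule continuous_on_eq) (use c in auto)
    then have "h \<in> borel_measurable (restrict_space borel ?U)"
      by (rule borel_measurable_continuous_on_restrict)
    moreover have "sets (restrict_space vol_M ?U) = sets (restrict_space borel ?U)"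
      using U chart_dom_subset[OF c]
      by (intro set_eqI) (subst sets_U, subst sets_restrict_space_iff, auto simp: borel_M_iff)
    ultimately show ?thesis
      using measurable_cong_sets[OF _ refl] by blast
  qed
  have "(\<integral>y. h y \<partial>vol_M) = (\<integral>y. indicator ?U y *\<^sub>R h y \<partial>vol_M)"
    using supp by (intro Bochner_Integration.integral_cong) (auto simp: indicator_def)
  also have "\<dots> = (\<integral>y. h y \<partial>restrict_space vol_M ?U)"
    using U by (subst integral_restrict_space) (auto simp: Int_absorb2 borel_M_subset)
  also have "\<dots> = (\<integral>z. h (chart_inv c z) \<partial>density ?L (\<lambda>z. ennreal (vol_density c z)))"
    using inv_meas h_meas by (subst vol_U, subst integral_distr) auto
  also have "\<dots> = (\<integral>z. vol_density c z *\<^sub>R h (chart_inv c z) \<partial>?L)"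
    using vol_density_meas measurable_compose[OF inv_meas h_meas] vol_density_pos[OF c]
    by (intro integral_density) (auto simp: AE_restrict_space_iff V less_imp_le)
  also have "\<dots> = (\<integral>z. indicator ?V z *\<^sub>R (vol_density c z * h (chart_inv c z)) \<partial>lborel)"
    using V by (subst integral_restrict_space) auto
  finally show ?thesis .
qed

end

section \<open>The operator on functions supported in a chart\<close>

text \<open>If \<open>F\<close> were larger than \<open>F'\<close> at \<open>a\<close>, it would be larger on a whole ball around \<open>a\<close>, and a tent
  supported in this ball would detect the difference.\<close>

lemma tent_integral_determines_value:
  fixes F F' :: "'a::euclidean_space \<Rightarrow> real"
  assumes W: "open W" "a \<in> W" and F: "continuous_on W F" and F': "continuous_on W F'"
    and eq: "\<And>s. s > 0 \<Longrightarrow> cball a s \<subseteq> W \<Longrightarrow>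
      (\<integral>w. max 0 (s - dist w a) * F w \<partial>lborel) = (\<integral>w. max 0 (s - dist w a) * F' w \<partial>lborel)"
  shows "F a \<le> F' a"
proof (rule ccontr)
  assume "\<not> F a \<le> F' a"
  then have pos: "0 < F a - F' a"
    by simp
  have cont: "continuous_on W (\<lambda>w. F w - F' w)"
    by (intro continuous_intros F F')
  have "open (W \<inter> (\<lambda>w. F w - F' w) -` {0<..})"
    using continuous_open_preimage[OF cont W(1)] by simp
  moreover have "a \<in> W \<inter> (\<lambda>w. F w - F' w) -` {0<..}"
    using pos W(2) by simp
  ultimately obtain s where s: "s > 0" "cball a s \<subseteq> W \<inter> (\<lambda>w. F w - F' w) -` {0<..}"
    unfolding open_contains_cball by blast
  let ?\<phi> = "\<lambda>w. max 0 (s - dist w a)"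
  have int: "integrable lborel (\<lambda>w. ?\<phi> w * h w)" if "continuous_on W h" for h
  proof -
    have "continuous_on (cball a s) (\<lambda>w. ?\<phi> w * h w)"
      using s(2) by (intro continuous_intros continuous_on_subset[OF that]) auto
    then have "integrable lborel (\<lambda>w. indicator (cball a s) w *\<^sub>R (?\<phi> w * h w))"
      by (intro borel_integrable_compact compact_cball)
    also have "(\<lambda>w. indicator (cball a s) w *\<^sub>R (?\<phi> w * h w)) = (\<lambda>w. ?\<phi> w * h w)"
      by (auto simp: fun_eq_iff indicator_def dist_commute)
    finally show ?thesis .
  qed
  let ?H = "\<lambda>w. ?\<phi> w * F w - ?\<phi> w * F' w"
  have H_pos: "?H w > 0" if "w \<in> ball a s" for w
  proof -
    have "F w - F' w > 0"
      using s(2) that ball_subset_cball by blast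
    moreover have "?\<phi> w > 0"
      using that by (simp add: dist_commute)
    ultimately show ?thesis
      by (simp only: right_diff_distrib[symmetric]) simp
  qed
  have H_nonneg: "?H w \<ge> 0" for w
  proof (cases "w \<in> ball a s")
    case False
    then have "?\<phi> w = 0"
      by (simp add: dist_commute)
    then show ?thesis
      by simp
  qed (use H_pos in force)
  have "integrable lborel ?H"
    by (intro Bochner_Integration.integrable_diff int F F')
  moreover have "(\<integral>w. ?H w \<partial>lborel) = 0"
    using eq[OF s(1)] s(2) int[OF F] int[OF F'] by (subst Bochner_Integration.integral_diff) auto
  ultimately have "AE w in lborel. ?H w = 0"
    using H_nonneg integral_nonneg_eq_0_iff_AE[of lborel ?H] by simp
  then have "AE w in lborel. w \<notin> ball a s"
    by (rule eventually_mono) (use H_pos in force)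
  then have "ball a s \<in> null_sets lborel"
    using AE_iff_null_sets[of "ball a s" lborel] by simp
  then have "negligible (ball a s)"
    using negligible_iff_null_sets null_sets_completionI by blast
  then show False
    using open_not_negligible[of "ball a s"] s(1) by simp
qed

context riemannian_manifold
begin

lemma geodesic_dist_locally_Lipschitz:
  assumes c: "c \<in> A" "z \<in> chart_img c"
  obtains r C where "r > 0" "cball z r \<subseteq> chart_img c"
    "\<And>p q. p \<in> cball z r \<Longrightarrow> q \<in> cball z r \<Longrightarrow>
      geodesic_dist M A g (chart_inv c p) (chart_inv c q) \<le> ereal (C * dist p q)"
proof -
  obtain r where r: "r > 0" "cball z r \<subseteq> chart_img c"
    and upper: "\<And>y v. y \<in> cball z r \<Longrightarrow> gram_norm c y v \<le> 2 * gram_norm c z v"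
    by (rule gram_norm_comparison[OF c, of 2]) auto
  obtain B where B: "\<And>v. gram_norm c z v \<le> B * norm v"
    using gram_norm_equivalent[OF c] by metis
  have "geodesic_dist M A g (chart_inv c p) (chart_inv c q) \<le> ereal (2 * B * dist p q)"
    if "p \<in> cball z r" "q \<in> cball z r" for p q
  proof -
    have "2 * gram_norm c z (q - p) \<le> 2 * B * dist p q"
      using B[of "q - p"] by (simp add: dist_norm norm_minus_commute)
    then show ?thesis
      using geodesic_dist_le_gram_norm[OF c(1) r(2) upper that] by (metis ereal_less_eq(3) order_trans)
  qed
  with r show ?thesis
    by (rule that)
qed

text \<open>Near \<open>x\<close> the distance from \<open>x\<close> is finite, and by the triangle inequality it is Lipschitz in
  coordinates.\<close>

lemma geodesic_dist_chart_continuous: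
  assumes c: "c \<in> A" "x \<in> chart_dom c"
  obtains r \<delta> where "r > 0" "cball (chart_map c x) r \<subseteq> chart_img c"
    "continuous_on (cball (chart_map c x) r) \<delta>" "\<delta> (chart_map c x) = 0"
    "\<And>w. w \<in> cball (chart_map c x) r \<Longrightarrow> \<delta> w \<ge> 0 \<and> geodesic_dist M A g x (chart_inv c w) = ereal (\<delta> w)"
proof -
  let ?z = "chart_map c x" and ?d = "geodesic_dist M A g"
  have z: "?z \<in> chart_img c" and x: "chart_inv c ?z = x"
    using c by auto
  obtain r C where r: "r > 0" "cball ?z r \<subseteq> chart_img c"
    and lip: "\<And>p q. p \<in> cball ?z r \<Longrightarrow> q \<in> cball ?z r \<Longrightarrow> ?d (chart_inv c p) (chart_inv c q) \<le> ereal (C * dist p q)"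
    using geodesic_dist_locally_Lipschitz[OF c(1) z] by metis
  define \<delta> where "\<delta> w = real_of_ereal (?d x (chart_inv c w))" for w
  have zr: "?z \<in> cball ?z r"
    using r by simp
  have \<delta>: "?d x (chart_inv c w) = ereal (\<delta> w)" if "w \<in> cball ?z r" for w
  proof -
    have "?d x (chart_inv c w) \<le> ereal (C * dist ?z w)"
      using lip[OF zr that] by (simp only: x)
    then have "\<bar>?d x (chart_inv c w)\<bar> \<noteq> \<infinity>"
      using geodesic_dist_nonneg[of x "chart_inv c w"] by auto
    then show ?thesis
      by (simp add: \<delta>_def ereal_real)
  qed
  have \<delta>_nonneg: "\<delta> w \<ge> 0" for w
    by (simp add: \<delta>_def real_of_ereal_pos geodesic_dist_nonneg)
  have \<delta>_le: "\<delta> w \<le> \<delta> w' + C * dist w' w" if "w \<in> cball ?z r" "w' \<in> cball ?z r" for w w'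
  proof -
    have "ereal (\<delta> w) \<le> ereal (\<delta> w') + ?d (chart_inv c w') (chart_inv c w)"
      using geodesic_dist_triangle[of x "chart_inv c w" "chart_inv c w'"] \<delta> that by simp
    also have "\<dots> \<le> ereal (\<delta> w') + ereal (C * dist w' w)"
      by (intro add_left_mono lip that)
    finally show ?thesis
      by simp
  qed
  have "\<bar>C\<bar>-lipschitz_on (cball ?z r) \<delta>"
  proof (rule lipschitz_onI)
    fix w w' assume w: "w \<in> cball ?z r" "w' \<in> cball ?z r"
    have "C * dist w w' \<le> \<bar>C\<bar> * dist w w'"
      by (intro mult_right_mono) auto
    then show "dist (\<delta> w) (\<delta> w') \<le> \<bar>C\<bar> * dist w w'"
      using \<delta>_le[OF w] \<delta>_le[OF w(2,1)] by (simp add: dist_real_def dist_commute abs_le_iff)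
  qed simp
  then have "continuous_on (cball ?z r) \<delta>"
    by (rule lipschitz_on_continuous_on)
  moreover have "\<delta> ?z = 0"
    using lip[OF zr zr] \<delta>[OF zr] \<delta>_nonneg[of ?z] by (simp only: x) simp
  ultimately show ?thesis
    using that[of r \<delta>] r \<delta> \<delta>_nonneg by blast
qed

end

context compact_riemannian_manifold
begin

definition chart_tent :: "('m, 'n) chart \<Rightarrow> real ^ 'n \<Rightarrow> real \<Rightarrow> 'm \<Rightarrow> real" where
  "chart_tent c a s y = (if y \<in> chart_dom c then max 0 (s - dist (chart_map c y) a) else 0)"

text \<open>The tent vanishes outside a compact set, which is closed in \<open>M\<close>, so that extension by zero beyond
  the chart domain is continuous.\<close>

lemma continuous_on_chart_tent:
  assumes c: "c \<in> A" and s: "cball a s \<subseteq> chart_img c"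
  shows "continuous_on M (chart_tent c a s)"
proof -
  let ?K = "chart_inv c ` cball a s"
  have "compact ?K"
    using s by (intro compact_continuous_image continuous_on_subset[OF continuous_on_chart_inv[OF c]]) auto
  then have "closed ?K"
    by (rule compact_imp_closed)
  then have "openin (top_of_set M) (M - ?K)"
    by (simp add: Diff_eq openin_open_Int open_Compl)
  moreover have "openin (top_of_set M) (chart_dom c)"
    by (rule openin_chart_dom[OF c])
  moreover have Un: "chart_dom c \<union> (M - ?K) = M"
    using chart_dom_subset[OF c] s c by auto
  moreover have "continuous_on (chart_dom c) (chart_tent c a s)"
  proof (rule continuous_on_eq)
    show "continuous_on (chart_dom c) (\<lambda>y. max 0 (s - dist (chart_map c y) a))"
      by (intro continuous_intros continuous_on_chart_map[OF c])
  qed (simp add: chart_tent_def)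
  moreover have "continuous_on (M - ?K) (chart_tent c a s)"
  proof (rule continuous_on_eq[OF continuous_on_const])
    fix y assume y: "y \<in> M - ?K"
    show "0 = chart_tent c a s y"
    proof (cases "y \<in> chart_dom c")
      case True
      then have "chart_map c y \<notin> cball a s"
        using y c by (metis DiffD2 chart_inv_chart_map image_eqI)
      then show ?thesis
        by (simp add: chart_tent_def dist_commute)
    qed (simp add: chart_tent_def)
  qed
  ultimately show ?thesis
    using continuous_on_Un_local_open[of "chart_dom c" "M - ?K" "chart_tent c a s"] by simp
qed

text \<open>The tent vanishes at \<open>x\<close>, so only the term with \<open>f y\<close> survives, and it can be computed in the chart.\<close>

lemma L_op_chart_tent:
  assumes c: "c \<in> A" "x \<in> chart_dom c" and p: "continuous_on M p" and t: "t > 0"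
    and r: "cball (chart_map c x) r \<subseteq> chart_img c"
    and \<delta>: "continuous_on (cball (chart_map c x) r) \<delta>"
      "\<And>w. w \<in> cball (chart_map c x) r \<Longrightarrow> geodesic_dist M A g x (chart_inv c w) = ereal (\<delta> w)"
    and a: "cball a s \<subseteq> ball (chart_map c x) r - {chart_map c x}"
  shows "L_op M A t p g (chart_tent c a s) x = - (1 / t powr (real CARD('n) / 2 + 1)) *
    (\<integral>w. max 0 (s - dist w a) * (vol_density c w * exp (- (\<delta> w)\<^sup>2 / t) * p (chart_inv c w)) \<partial>lborel)"
proof -
  let ?z = "chart_map c x" and ?f = "chart_tent c a s"
  let ?\<phi> = "\<lambda>w. max 0 (s - dist w a)"
  let ?h = "\<lambda>y. gauss_kernel t (geodesic_dist M A g x y) * (?f x - ?f y) * p y"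
  have f_inv: "?f (chart_inv c w) = ?\<phi> w" if "w \<in> chart_img c" for w
    using that c by (simp add: chart_tent_def)
  have "?z \<notin> cball a s"
    using a by blast
  then have fx: "?f x = 0"
    by (simp add: chart_tent_def dist_commute)
  have \<phi>0: "?\<phi> w = 0" if "w \<notin> cball a s" for w
    using that by (simp add: dist_commute)
  have h_ball: "?h (chart_inv c w) = - (?\<phi> w * (exp (- (\<delta> w)\<^sup>2 / t) * p (chart_inv c w)))" if "w \<in> ball ?z r" for w
  proof -
    have "w \<in> cball ?z r"
      using that by auto
    then show ?thesis
      using \<delta>(2)[of w] f_inv[of w] r by (simp add: fx gauss_kernel_def subset_iff)
  qed
  have p_cont: "continuous_on (chart_img c) (\<lambda>w. p (chart_inv c w))"
    using chart_dom_in_M[OF c(1)] c(1)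
    by (intro continuous_on_compose2[OF p continuous_on_chart_inv]) auto
  have h_cont: "continuous_on (chart_img c) (\<lambda>w. ?h (chart_inv c w))"
  proof -
    have "continuous_on (ball ?z r) (\<lambda>w. - (?\<phi> w * (exp (- (\<delta> w)\<^sup>2 / t) * p (chart_inv c w))))"
      using r by (intro continuous_intros continuous_on_subset[OF \<delta>(1)] continuous_on_subset[OF p_cont]) (use t in auto)
    then have "continuous_on (ball ?z r) (\<lambda>w. ?h (chart_inv c w))"
      by (rule continuous_on_eq) (simp only: h_ball)
    moreover have "continuous_on (chart_img c - cball a s) (\<lambda>w. ?h (chart_inv c w))"
    proof (rule continuous_on_eq[OF continuous_on_const])
      fix w assume "w \<in> chart_img c - cball a s"
      then show "0 = ?h (chart_inv c w)"
        using f_inv[of w] \<phi>0[of w] fx by simp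
    qed
    moreover have "open (ball ?z r)" "open (chart_img c - cball a s)"
      using open_chart_img[OF c(1)] by auto
    ultimately have "continuous_on (ball ?z r \<union> (chart_img c - cball a s)) (\<lambda>w. ?h (chart_inv c w))"
      by (intro continuous_on_open_Un)
    then show ?thesis
      by (rule continuous_on_subset) (use a in auto)
  qed
  have "(\<integral>y. ?h y \<partial>vol_M) = (\<integral>w. indicator (chart_img c) w *\<^sub>R (vol_density c w * ?h (chart_inv c w)) \<partial>lborel)"
  proof (rule integral_vol_M_chart[OF c(1) _ h_cont])
    fix y assume "y \<notin> chart_dom c"
    then have "?f y = 0"
      by (simp add: chart_tent_def)
    then show "?h y = 0"
      by (simp add: fx)
  qed
  also have "\<dots> = (\<integral>w. - (?\<phi> w * (vol_density c w * exp (- (\<delta> w)\<^sup>2 / t) * p (chart_inv c w))) \<partial>lborel)"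
  proof (rule Bochner_Integration.integral_cong[OF refl])
    fix w
    show "indicator (chart_img c) w *\<^sub>R (vol_density c w * ?h (chart_inv c w))
        = - (?\<phi> w * (vol_density c w * exp (- (\<delta> w)\<^sup>2 / t) * p (chart_inv c w)))"
    proof (cases "w \<in> cball a s")
      case True
      then have "w \<in> ball ?z r" "w \<in> chart_img c"
        using a r ball_subset_cball by blast+
      then show ?thesis
        by (simp only: h_ball) simp
    next
      case False
      then show ?thesis
        using f_inv[of w] \<phi>0[of w] fx by (simp add: indicator_def)
    qed
  qed
  finally show ?thesis
    by (simp add: L_op_def)
qed

end

section \<open>Two metrics with the same operator\<close>

locale two_metrics =
  R1: compact_riemannian_manifold M A g1 k1 + R2: compact_riemannian_manifold M A g2 k2
  for M :: "'m::t2_space set" and A :: "('m, 'n::finite) chart set" and g1 g2 k1 k2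
begin

text \<open>For \<open>w = z + m v\<close> with small \<open>m > 0\<close>, the distance is at least \<open>m |v|\<^sub>1 / K\<close> and at most
  \<open>K m |v|\<^sub>2\<close>, for any \<open>K > 1\<close>.\<close>

lemma gram_norm_le_of_geodesic_dist_eq:
  assumes c: "c \<in> A" "z \<in> R1.chart_img c" and r: "r > 0"
    and eq: "\<And>w. w \<in> ball z r \<Longrightarrow> w \<in> R1.chart_img c \<Longrightarrow>
      geodesic_dist M A g1 (chart_inv c z) (chart_inv c w) = geodesic_dist M A g2 (chart_inv c z) (chart_inv c w)"
  shows "R1.gram_norm c z v \<le> R2.gram_norm c z v"
proof (rule field_le_mult_one_interval)
  fix q :: real assume q: "0 < q" "q < 1"
  \<comment> \<open>The factor \<open>K * K = 1 / q\<close> is the one lost by using both bounds.\<close>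
  define K where "K = 1 / sqrt q"
  have "sqrt q < 1"
    using q by simp
  then have K: "K > 1" "K * K = 1 / q"
    using q by (simp_all add: K_def)
  obtain d where d: "d > 0" and lower: "\<And>y. y \<in> R1.chart_img c \<Longrightarrow> dist y z < d \<Longrightarrow>
      ereal (R1.gram_norm c z (y - z) / K) \<le> geodesic_dist M A g1 (chart_inv c z) (chart_inv c y)"
    using R1.gram_norm_le_geodesic_dist[OF c K(1)] by metis
  obtain r' where r': "r' > 0" "cball z r' \<subseteq> R1.chart_img c"
    and comp: "\<And>y v. y \<in> cball z r' \<Longrightarrow> R2.gram_norm c y v \<le> K * R2.gram_norm c z v"
    using R2.gram_norm_comparison[OF c K(1)] by metis
  define e where "e = min d (min r r')"
  have e: "e > 0"
    using d r r'(1) by (simp add: e_def)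
  \<comment> \<open>Adding \<open>1\<close> to the norm covers the case \<open>v = 0\<close>.\<close>
  define m where "m = (e / 2) / (norm v + 1)"
  have m: "m > 0"
    using e by (simp add: m_def add_nonneg_pos)
  define w where "w = z + m *\<^sub>R v"
  have "norm (m *\<^sub>R v) < e"
  proof -
    have "norm (m *\<^sub>R v) \<le> m * (norm v + 1)"
      using m by simp
    also have "m * (norm v + 1) = e / 2"
      unfolding m_def using add_nonneg_pos[OF norm_ge_zero[of v] zero_less_one]
      by (intro nonzero_eq_divide_eq[THEN iffD1]) auto
    also have "\<dots> < e"
      using e by simp
    finally show ?thesis .
  qed
  then have w_close: "dist w z < d" "w \<in> ball z r" "w \<in> cball z r'"
    by (auto simp: w_def dist_norm e_def)
  then have w_img: "w \<in> R1.chart_img c"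
    using r'(2) by blast
  have "ereal (R1.gram_norm c z (m *\<^sub>R v) / K) \<le> geodesic_dist M A g2 (chart_inv c z) (chart_inv c w)"
    using lower[OF w_img w_close(1)] eq[OF w_close(2) w_img] by (simp add: w_def)
  also have "\<dots> \<le> ereal (K * R2.gram_norm c z (m *\<^sub>R v))"
    using R2.geodesic_dist_le_gram_norm[OF c(1) r'(2) comp _ w_close(3), of z] r'(1) by (simp add: w_def)
  finally have "R1.gram_norm c z (m *\<^sub>R v) / K \<le> K * R2.gram_norm c z (m *\<^sub>R v)"
    by simp
  then have "m * (R1.gram_norm c z v / K) \<le> m * (K * R2.gram_norm c z v)"
    using m by (simp add: R1.gram_norm_scaleR[OF c] R2.gram_norm_scaleR[OF c] mult.left_commute)
  then have "R1.gram_norm c z v / K \<le> K * R2.gram_norm c z v"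
    using mult_le_cancel_left_pos[OF m] by blast
  then have "R1.gram_norm c z v \<le> (K * K) * R2.gram_norm c z v"
    using K(1) by (simp add: field_simps)
  then show "q * R1.gram_norm c z v \<le> R2.gram_norm c z v"
    using q K(2) by (simp add: field_simps)
qed

text \<open>The norms agree, and a symmetric bilinear form is determined by its quadratic form.\<close>

lemma metric_eq_of_geodesic_dist_eq:
  assumes c: "c \<in> A" "x \<in> chart_dom c" and r: "r > 0"
    and eq: "\<And>w. w \<in> ball (chart_map c x) r \<Longrightarrow> w \<in> R1.chart_img c \<Longrightarrow>
      geodesic_dist M A g1 x (chart_inv c w) = geodesic_dist M A g2 x (chart_inv c w)"
    and v: "v \<in> tangent_space A x" and w: "w \<in> tangent_space A x"
  shows "g1 x v w = g2 x v w"
proof -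
  let ?z = "chart_map c x"
  let ?G1 = "gram A g1 c ?z" and ?G2 = "gram A g2 c ?z"
  have z: "?z \<in> R1.chart_img c"
    using c by simp
  interpret swapped: two_metrics M A g2 g1 k2 k1 ..
  have "R1.gram_norm c ?z u = R2.gram_norm c ?z u" for u
    using gram_norm_le_of_geodesic_dist_eq[OF c(1) z r, of u] swapped.gram_norm_le_of_geodesic_dist_eq[OF c(1) z r, of u]
      eq c by (intro antisym) auto
  then have quad: "u \<bullet> (?G1 *v u) = u \<bullet> (?G2 *v u)" for u
    using R1.gram_norm_square[OF c(1) z, of u] R2.gram_norm_square[OF c(1) z, of u] by simp
  have polar: "(a + b) \<bullet> (gram A g' c ?z *v (a + b)) = a \<bullet> (gram A g' c ?z *v a) + 2 * (a \<bullet> (gram A g' c ?z *v b)) + b \<bullet> (gram A g' c ?z *v b)"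
    if "b \<bullet> (gram A g' c ?z *v a) = a \<bullet> (gram A g' c ?z *v b)" for a b g'
    using that by (simp add: matrix_vector_right_distrib inner_add_left inner_add_right)
  have "a \<bullet> (?G1 *v b) = a \<bullet> (?G2 *v b)" for a b
    using polar[OF R1.gram_commute[OF c(1) z, of b a]] polar[OF R2.gram_commute[OF c(1) z, of b a]]
      quad[of a] quad[of b] quad[of "a + b"] by simp
  then show ?thesis
    using R1.metric_eq_gram[OF c v w] R2.metric_eq_gram[OF c v w] by simp
qed

context
  fixes t :: real and p :: "'m \<Rightarrow> real"
  assumes t: "t > 0" and p: "continuous_on M p" and p_pos: "\<And>y. y \<in> M \<Longrightarrow> p y > 0"
    and L_eq: "\<And>f x. continuous_on M f \<Longrightarrow> x \<in> M \<Longrightarrow> L_op M A t p g1 f x = L_op M A t p g2 f x"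
begin

text \<open>Tents give equality at every point other than the centre, which they have to avoid in order to vanish
  there. At the centre it follows by continuity.\<close>

lemma kernel_density_eq:
  assumes c: "c \<in> A" "x \<in> chart_dom c"
    and r: "r > 0" "cball (chart_map c x) r \<subseteq> R1.chart_img c"
    and \<delta>1: "continuous_on (cball (chart_map c x) r) \<delta>1"
      "\<And>w. w \<in> cball (chart_map c x) r \<Longrightarrow> geodesic_dist M A g1 x (chart_inv c w) = ereal (\<delta>1 w)"
    and \<delta>2: "continuous_on (cball (chart_map c x) r) \<delta>2"
      "\<And>w. w \<in> cball (chart_map c x) r \<Longrightarrow> geodesic_dist M A g2 x (chart_inv c w) = ereal (\<delta>2 w)"
    and w: "w \<in> ball (chart_map c x) r"
  shows "R1.vol_density c w * exp (- (\<delta>1 w)\<^sup>2 / t) = R2.vol_density c w * exp (- (\<delta>2 w)\<^sup>2 / t)"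
proof -
  let ?z = "chart_map c x"
  let ?W = "ball ?z r - {?z}"
  let ?F1 = "\<lambda>w. R1.vol_density c w * exp (- (\<delta>1 w)\<^sup>2 / t) * p (chart_inv c w)"
  let ?F2 = "\<lambda>w. R2.vol_density c w * exp (- (\<delta>2 w)\<^sup>2 / t) * p (chart_inv c w)"
  have ball_sub: "ball ?z r \<subseteq> R1.chart_img c" "ball ?z r \<subseteq> cball ?z r"
    using r(2) by auto
  have p_cont: "continuous_on (ball ?z r) (\<lambda>w. p (chart_inv c w))"
    using ball_sub R1.chart_dom_in_M[OF c(1)] c(1)
    by (intro continuous_on_compose2[OF p continuous_on_subset[OF R1.continuous_on_chart_inv]]) auto
  have cont: "continuous_on (ball ?z r) ?F1" "continuous_on (ball ?z r) ?F2"
    using ball_sub t c(1)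
    by (auto intro!: continuous_intros p_cont continuous_on_subset[OF \<delta>1(1)] continuous_on_subset[OF \<delta>2(1)]
        continuous_on_subset[OF R1.continuous_on_vol_density] continuous_on_subset[OF R2.continuous_on_vol_density])
  have eq_W: "?F1 a = ?F2 a" if a: "a \<in> ?W" for a
  proof -
    have "open ?W"
      by (intro open_Diff open_ball closed_singleton)
    have tents: "(\<integral>w. max 0 (s - dist w a) * ?F1 w \<partial>lborel) = (\<integral>w. max 0 (s - dist w a) * ?F2 w \<partial>lborel)"
      if s: "cball a s \<subseteq> ?W" for s
    proof -
      have "continuous_on M (R1.chart_tent c a s)"
        using s ball_sub by (intro R1.continuous_on_chart_tent c) auto
      then have "L_op M A t p g1 (R1.chart_tent c a s) x = L_op M A t p g2 (R1.chart_tent c a s) x"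
        using L_eq R1.chart_dom_in_M[OF c] by blast
      then show ?thesis
        using R1.L_op_chart_tent[OF c p t r(2) \<delta>1 s] R2.L_op_chart_tent[OF c p t r(2) \<delta>2 s] t
        by (simp add: R1.chart_tent_def[abs_def] R2.chart_tent_def[abs_def])
    qed
    have cont': "continuous_on ?W ?F1" "continuous_on ?W ?F2"
      using cont continuous_on_subset by blast+
    show ?thesis
      by (rule antisym[OF tent_integral_determines_value[OF \<open>open ?W\<close> a cont' tents]
        tent_integral_determines_value[OF \<open>open ?W\<close> a cont'(2,1) tents[symmetric]]])
  qed
  have "?F1 w = ?F2 w"
  proof (cases "w = ?z")
    case True
    have lim: "(?F1 \<longlongrightarrow> ?F1 ?z) (at ?z)" "(?F2 \<longlongrightarrow> ?F2 ?z) (at ?z)"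
      using cont r(1) by (simp_all add: continuous_on_eq_continuous_at isCont_def)
    have "eventually (\<lambda>y. ?F1 y = ?F2 y) (at ?z)"
      unfolding eventually_at_topological using eq_W r(1) by (intro exI[of _ "ball ?z r"]) auto
    from Lim_transform_eventually[OF lim(1) this] have "?F1 ?z = ?F2 ?z"
      by (rule tendsto_unique[OF at_neq_bot _ lim(2)])
    then show ?thesis
      unfolding True .
  qed (use w eq_W in auto)
  moreover have "p (chart_inv c w) > 0"
    using w ball_sub c(1) by (intro p_pos R1.chart_dom_in_M[OF c(1)]) auto
  ultimately show ?thesis
    by simp
qed

text \<open>At the centre of each ball both distances vanish, so \<open>kernel_density_eq\<close> gives equality of the
  volume densities; as every point is such a centre, the densities can then be
  cancelled at all points, and equality of the distances remains.\<close>

lemma metric_eq: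
  assumes x: "x \<in> M" and v: "v \<in> tangent_space A x" and w: "w \<in> tangent_space A x"
  shows "g1 x v w = g2 x v w"
proof -
  obtain c where c: "c \<in> A" "x \<in> chart_dom c"
    using R1.ex_chart[OF x] by metis
  have vol_density_eq: "R1.vol_density c (chart_map c y) = R2.vol_density c (chart_map c y)"
    and dist_eq: "\<exists>r>0. \<forall>w\<in>ball (chart_map c y) r. w \<in> R1.chart_img c \<longrightarrow>
      R1.vol_density c w = R2.vol_density c w \<longrightarrow> geodesic_dist M A g1 y (chart_inv c w) = geodesic_dist M A g2 y (chart_inv c w)"
    if y: "y \<in> chart_dom c" for y
  proof -
    let ?z = "chart_map c y"
    obtain r1 \<delta>1 where r1: "r1 > 0" "cball ?z r1 \<subseteq> R1.chart_img c" "continuous_on (cball ?z r1) \<delta>1" "\<delta>1 ?z = 0"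
      "\<And>w. w \<in> cball ?z r1 \<Longrightarrow> \<delta>1 w \<ge> 0 \<and> geodesic_dist M A g1 y (chart_inv c w) = ereal (\<delta>1 w)"
      using R1.geodesic_dist_chart_continuous[OF c(1) y] by metis
    obtain r2 \<delta>2 where r2: "r2 > 0" "cball ?z r2 \<subseteq> R1.chart_img c" "continuous_on (cball ?z r2) \<delta>2" "\<delta>2 ?z = 0"
      "\<And>w. w \<in> cball ?z r2 \<Longrightarrow> \<delta>2 w \<ge> 0 \<and> geodesic_dist M A g2 y (chart_inv c w) = ereal (\<delta>2 w)"
      using R2.geodesic_dist_chart_continuous[OF c(1) y] by metis
    let ?r = "min r1 r2"
    have sub: "cball ?z ?r \<subseteq> cball ?z r1" "cball ?z ?r \<subseteq> cball ?z r2"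
      by auto
    have density: "R1.vol_density c w * exp (- (\<delta>1 w)\<^sup>2 / t) = R2.vol_density c w * exp (- (\<delta>2 w)\<^sup>2 / t)"
      if "w \<in> ball ?z ?r" for w
    proof (rule kernel_density_eq[OF c(1) y _ _ _ _ _ _ that])
      show "continuous_on (cball ?z ?r) \<delta>1" "continuous_on (cball ?z ?r) \<delta>2"
        using r1(3) r2(3) sub continuous_on_subset by blast+
    qed (use r1 r2 sub in auto)
    \<comment> \<open>Both distances vanish at the centre.\<close>
    from density[of ?z] show "R1.vol_density c ?z = R2.vol_density c ?z"
      using r1(1,4) r2(1,4) by simp
    have "geodesic_dist M A g1 y (chart_inv c w) = geodesic_dist M A g2 y (chart_inv c w)"
      if w: "w \<in> ball ?z ?r" and vol_density: "R1.vol_density c w = R2.vol_density c w" for w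
    proof -
      have w': "w \<in> cball ?z r1" "w \<in> cball ?z r2"
        using w by auto
      then have "R2.vol_density c w > 0"
        using r2(2) by (intro R2.vol_density_pos[OF c(1)]) auto
      then have "(\<delta>1 w)\<^sup>2 = (\<delta>2 w)\<^sup>2"
        using density[OF w] vol_density t by simp
      then have "\<delta>1 w = \<delta>2 w"
        using r1(5)[OF w'(1)] r2(5)[OF w'(2)] power2_eq_iff_nonneg by blast
      then show ?thesis
        using r1(5)[OF w'(1)] r2(5)[OF w'(2)] by simp
    qed
    then show "\<exists>r>0. \<forall>w\<in>ball ?z r. w \<in> R1.chart_img c \<longrightarrow>
      R1.vol_density c w = R2.vol_density c w \<longrightarrow> geodesic_dist M A g1 y (chart_inv c w) = geodesic_dist M A g2 y (chart_inv c w)"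
      using r1(1) r2(1) by (intro exI[of _ ?r]) auto
  qed
  obtain r where "r > 0" and r: "\<And>w. w \<in> ball (chart_map c x) r \<Longrightarrow> w \<in> R1.chart_img c \<Longrightarrow>
      R1.vol_density c w = R2.vol_density c w \<Longrightarrow> geodesic_dist M A g1 x (chart_inv c w) = geodesic_dist M A g2 x (chart_inv c w)"
    using dist_eq[OF c(2)] by blast
  show ?thesis
    by (rule metric_eq_of_geodesic_dist_eq[OF c \<open>r > 0\<close> r v w]) (use vol_density_eq in auto)
qed

end

end

theorem theorem2p2:
  fixes M :: "'m::t2_space set"
    and A :: "('m, 'n::finite) chart set"
    and t :: real
    and p :: "'m \<Rightarrow> real"
    and g\<^sub>1 g\<^sub>2 :: "('m, 'n) metric"
  assumes "compact M" and "smooth_atlas M A"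
    and "t > 0"
    and "continuous_on M p" and "\<forall>x\<in>M. p x > 0"
    and "riemannian_metric 2 M A g\<^sub>1" and "riemannian_metric 2 M A g\<^sub>2"
    and "\<forall>f. continuous_on M f \<longrightarrow> (\<forall>x\<in>M. L_op M A t p g\<^sub>1 f x = L_op M A t p g\<^sub>2 f x)"
  shows "\<forall>x\<in>M. \<forall>v\<in>tangent_space A x. \<forall>w\<in>tangent_space A x. g\<^sub>1 x v w = g\<^sub>2 x v w"
proof -
  interpret two_metrics M A g\<^sub>1 g\<^sub>2 2 2
    using assms by unfold_locales
  show ?thesis
    using metric_eq[of t p] assms by blast
qed

end
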